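(* Let $Y$ be a complex Banach space, let $X$ be a $2$-concave and $2$-convex Banach function space, let $1\le r<2$, and let $v:Y\to X$ be an $(r,1)$-summing operator. Then for any $\varepsilon>0$ there is $\kappa>0$ such that $$\left(\sum_{|\alpha|=m}\|v c_\alpha\|_X^{\frac{2mr}{2+(m-1)r}}\right)^{\frac{2+(m-1)r}{2mr}}\le\kappa(1+\varepsilon)^m\|P\|_{\mathbb D^n}$$ holds for all positive integers $m$ and $n$ and every $m$-homogeneous polynomial $P:\ell_\infty^n\to Y$, $P(z)=\sum_{|\alpha|=m}c_\alpha z^\alpha$ (with $c_\alpha\in Y$).
   Context: All Banach spaces are complex. Banach function space (B.f.s.): let $(\Omega,\Sigma,\mu)$ be a positive finite measure space and $L^0(\mu)$ the space of (classes modulo $\mu$-null functions of) complex-valued $\Sigma$-measurable functions. A B.f.s. is an order ideal $X\subset L^0(\mu)$ containing all $\Sigma$-simple functions and equipped with a complete lattice norm ($|f|\le|g|$ implies $\|f\|_X\le\|g\|_X$). $X$ is $q$-concave if there is $C>0$ with $\left(\sum_{i=1}^N\|x_i\|^q\right)^{1/q}\le C\left\|\left(\sum_{i=1}^N|x_i|^q\right)^{1/q}\right\|$ for all finite families in $X$. $X$ is $p$-convex if there is $C>0$ with $\left\|\left(\sum_{i=1}^N|x_i|^p\right)^{1/p}\right\|\le C\left(\sum_{i=1}^N\|x_i\|^p\right)^{1/p}$ for all finite families in $X$. A bounded linear operator $v:Y\to X$ is $(r,1)$-summing if there is $C>0$ such that $\left(\sum_{i=1}^N\|v x_i\|^r\right)^{1/r}\le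 C\sup_{\|y'\|_{Y'}\le1}\sum_{i=1}^N|y'(x_i)|$ for all finite families $x_1,\dots,x_N\in Y$. $\ell_\infty^n$ is $\mathbb C^n$ with the sup norm; $\alpha$ ranges over multi-indices in $\mathbb N_0^n$ with $|\alpha|=\alpha_1+\dots+\alpha_n$; $\mathbb D^n=\{z\in\mathbb C^n:|z_i|<1\text{ for all }i\}$ and $\|P\|_{\mathbb D^n}=\sup_{z\in\mathbb D^n}\|P(z)\|_Y$. *)

theory Defs
  imports "HOL-Analysis.Analysis"
begin

section \<open>Complex Banach spaces\<close>

class complex_normed_vector = real_normed_vector +
  fixes scaleC :: "complex \<Rightarrow> 'a \<Rightarrow> 'a" (infixr "*\<^sub>C" 75)
  assumes scaleC_add_right: "a *\<^sub>C (x + y) = a *\<^sub>C x + a *\<^sub>C y"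
    and scaleC_add_left: "(a + b) *\<^sub>C x = a *\<^sub>C x + b *\<^sub>C x"
    and scaleC_scaleC: "a *\<^sub>C b *\<^sub>C x = (a * b) *\<^sub>C x"
    and scaleR_scaleC: "scaleR t x = complex_of_real t *\<^sub>C x"
    and norm_scaleC: "norm (a *\<^sub>C x) = cmod a * norm x"

class complex_banach = complex_normed_vector + banach

instantiation complex :: complex_banach
begin

definition scaleC_complex :: "complex \<Rightarrow> complex \<Rightarrow> complex"
  where "scaleC_complex a x = a * x"

instance
  by standard (auto simp: scaleC_complex_def algebra_simps norm_mult scaleR_conv_of_real)

end

definition dual_unit_ball :: "('y::complex_normed_vector \<Rightarrow> complex) set"
  where "dual_unit_ball =
    {\<phi>. bounded_linear \<phi> \<and> (\<forall>a x. \<phi> (a *\<^sub>C x) = a * \<phi> x) \<and> onorm \<phi> \<le> 1}"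

section \<open>Banach function spaces\<close>

text \<open>
  Elements of \<open>L\<^sup>0(\<mu>)\<close> are represented by measurable functions. The set \<open>X\<close> is
  the union of the classes belonging to the space; it is closed under almost everywhere
  equality by \<open>ideal\<close>, and the norm respects almost everywhere equality by
  \<open>norm_mono\<close>.
\<close>

locale banach_function_space = finite_measure M
  for M :: "'a measure" +
  fixes X :: "('a \<Rightarrow> complex) set"
    and nrm :: "('a \<Rightarrow> complex) \<Rightarrow> real"
  assumes measurable: "f \<in> X \<Longrightarrow> f \<in> borel_measurable M"
    and add_closed: "f \<in> X \<Longrightarrow> g \<in> X \<Longrightarrow> (\<lambda>\<omega>. f \<omega> + g \<omega>) \<in> X"
    and scale_closed: "f \<in> X \<Longrightarrow> (\<lambda>\<omega>. a * f \<omega>) \<in> X"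
    and ideal: "f \<in> borel_measurable M \<Longrightarrow> g \<in> X \<Longrightarrow>
      (AE \<omega> in M. cmod (f \<omega>) \<le> cmod (g \<omega>)) \<Longrightarrow> f \<in> X"
    and simple_mem: "simple_function M f \<Longrightarrow> f \<in> X"
    and norm_triangle: "f \<in> X \<Longrightarrow> g \<in> X \<Longrightarrow> nrm (\<lambda>\<omega>. f \<omega> + g \<omega>) \<le> nrm f + nrm g"
    and norm_scale: "f \<in> X \<Longrightarrow> nrm (\<lambda>\<omega>. a * f \<omega>) = cmod a * nrm f"
    and norm_definite: "f \<in> X \<Longrightarrow> nrm f = 0 \<Longrightarrow> (AE \<omega> in M. f \<omega> = 0)"
    and norm_mono: "f \<in> X \<Longrightarrow> g \<in> X \<Longrightarrow>
      (AE \<omega> in M. cmod (f \<omega>) \<le> cmod (g \<omega>)) \<Longrightarrow> nrm f \<le> nrm g"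
    and complete: "(\<And>k. F k \<in> X) \<Longrightarrow>
      (\<forall>e>0. \<exists>K. \<forall>j\<ge>K. \<forall>k\<ge>K. nrm (\<lambda>\<omega>. F j \<omega> - F k \<omega>) < e) \<Longrightarrow>
      \<exists>f\<in>X. (\<lambda>k. nrm (\<lambda>\<omega>. F k \<omega> - f \<omega>)) \<longlonglongrightarrow> 0"

definition lattice_sum :: "real \<Rightarrow> nat \<Rightarrow> (nat \<Rightarrow> 'a \<Rightarrow> complex) \<Rightarrow> 'a \<Rightarrow> complex"
  where "lattice_sum q N x =
    (\<lambda>\<omega>. complex_of_real ((\<Sum>i<N. cmod (x i \<omega>) powr q) powr (1 / q)))"

definition q_concave :: "real \<Rightarrow> ('a \<Rightarrow> complex) set \<Rightarrow> (('a \<Rightarrow> complex) \<Rightarrow> real) \<Rightarrow> bool"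
  where "q_concave q X nrm \<longleftrightarrow>
    (\<exists>C>0. \<forall>N x. (\<forall>i<N. x i \<in> X) \<longrightarrow>
      (\<Sum>i<N. nrm (x i) powr q) powr (1 / q) \<le> C * nrm (lattice_sum q N x))"

definition p_convex :: "real \<Rightarrow> ('a \<Rightarrow> complex) set \<Rightarrow> (('a \<Rightarrow> complex) \<Rightarrow> real) \<Rightarrow> bool"
  where "p_convex p X nrm \<longleftrightarrow>
    (\<exists>C>0. \<forall>N x. (\<forall>i<N. x i \<in> X) \<longrightarrow>
      nrm (lattice_sum p N x) \<le> C * (\<Sum>i<N. nrm (x i) powr p) powr (1 / p))"

section \<open>Summing operators\<close>

text \<open>Linearity is an identity in \<open>L\<^sup>0(\<mu>)\<close>, hence holds almost everywhere.\<close>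

definition bounded_operator_into ::
  "'a measure \<Rightarrow> ('a \<Rightarrow> complex) set \<Rightarrow> (('a \<Rightarrow> complex) \<Rightarrow> real) \<Rightarrow>
    ('y::complex_normed_vector \<Rightarrow> 'a \<Rightarrow> complex) \<Rightarrow> bool"
  where "bounded_operator_into M X nrm v \<longleftrightarrow>
    (\<forall>y. v y \<in> X) \<and>
    (\<forall>y z. AE \<omega> in M. v (y + z) \<omega> = v y \<omega> + v z \<omega>) \<and>
    (\<forall>a y. AE \<omega> in M. v (a *\<^sub>C y) \<omega> = a * v y \<omega>) \<and>
    (\<exists>K. \<forall>y. nrm (v y) \<le> K * norm y)"

definition r1_summing ::
  "real \<Rightarrow> 'a measure \<Rightarrow> ('a \<Rightarrow> complex) set \<Rightarrow> (('a \<Rightarrow> complex) \<Rightarrow> real) \<Rightarrow>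
    ('y::complex_normed_vector \<Rightarrow> 'a \<Rightarrow> complex) \<Rightarrow> bool"
  where "r1_summing r M X nrm v \<longleftrightarrow>
    bounded_operator_into M X nrm v \<and>
    (\<exists>C>0. \<forall>N x. (\<Sum>i<N. nrm (v (x i)) powr r) powr (1 / r)
      \<le> C * (SUP \<phi>\<in>dual_unit_ball. \<Sum>i<(N::nat). cmod (\<phi> (x i))))"

section \<open>Homogeneous polynomials\<close>

text \<open>
  Since the estimate is uniform in the dimension \<open>n\<close>, vectors in \<open>\<complex>\<^sup>n\<close> and multi-indices
  in \<open>\<nat>\<^sub>0\<^sup>n\<close> are extensional functions on \<open>{..<n}\<close>.
\<close>

definition complex_space :: "nat \<Rightarrow> (nat \<Rightarrow> complex) set"
  where "complex_space n = {..<n} \<rightarrow>\<^sub>E UNIV"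

definition polydisc :: "nat \<Rightarrow> (nat \<Rightarrow> complex) set"
  where "polydisc n = {z \<in> complex_space n. \<forall>i<n. cmod (z i) < 1}"

definition multi_indices :: "nat \<Rightarrow> nat \<Rightarrow> (nat \<Rightarrow> nat) set"
  where "multi_indices n m = {\<alpha> \<in> {..<n} \<rightarrow>\<^sub>E UNIV. (\<Sum>i<n. \<alpha> i) = m}"

definition homogeneous_polynomial_with_coeffs ::
  "nat \<Rightarrow> nat \<Rightarrow> ((nat \<Rightarrow> nat) \<Rightarrow> 'y::complex_normed_vector) \<Rightarrow> ((nat \<Rightarrow> complex) \<Rightarrow> 'y) \<Rightarrow> bool"
  where "homogeneous_polynomial_with_coeffs n m c P \<longleftrightarrow>
    (\<forall>z\<in>complex_space n. P z = (\<Sum>\<alpha>\<in>multi_indices n m. (\<Prod>i<n. z i ^ \<alpha> i) *\<^sub>C c \<alpha>))"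

definition polydisc_norm :: "nat \<Rightarrow> ((nat \<Rightarrow> complex) \<Rightarrow> 'y::complex_normed_vector) \<Rightarrow> real"
  where "polydisc_norm n P = (SUP z\<in>polydisc n. norm (P z))"

end

theory Submission
  imports Defs
begin

text \<open>
  Write \<open>\<rho>\<^sub>m\<close> for the exponent in degree \<open>m\<close>, so that
  \<open>1/\<rho>\<^sub>m - 1/2 = (1/m)(1/r - 1/2)\<close>. A bound \<open>C\<close> in degree \<open>k\<close> yields one in degree
  \<open>m \<ge> k\<close>. By Blei's inequality it is enough to bound, with \<open>p = \<rho>\<^sub>k\<close>, the \<open>\<ell>\<^sub>p\<close>-sum over
  \<open>|\<beta>| = k\<close> of the \<open>\<ell>\<^sub>2\<close>-sums of \<open>\<parallel>v c\<^bsub>\<beta>+\<gamma>\<^esub>\<parallel>\<close> over \<open>|\<gamma>| = m - k\<close>. Since \<open>X\<close> is 2-convex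
  and 2-concave, the inner sums are dominated by second moments of \<open>X\<close>-valued polynomials in
  \<open>z\<close>. Their fourth moments are controlled by their second moments, and Hoelder's inequality
  lowers the second moment to the \<open>p\<close>-th one at the cost of a factor \<open>2\<^bsup>(2/p-1)(m-k)\<^esup> \<le> 2\<^bsup>m/k\<^esup>\<close>.
  For fixed \<open>z\<close> the remaining sum is the one of degree \<open>k\<close> for the homogeneous part of degree
  \<open>k\<close> of \<open>w \<mapsto> P(z + w)\<close>, whose norm is at most \<open>t\<^bsup>-k\<^esup>(1 + t)\<^sup>m\<parallel>P\<parallel>\<close> by Cauchy's estimate.

  Degree 1 is the summing property of \<open>v\<close>. Going from degree 1 to degree \<open>k\<close>, and from \<open>k\<close> to
  \<open>m\<close>, with \<open>k\<close> large and \<open>t\<close> small depending on \<open>\<epsilon>\<close> only, gives the subexponential constant.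
\<close>

section \<open>Inequalities of Hoelder, Finner and Blei\<close>

text \<open>Concavity of \<open>ln\<close> gives the bound when every \<open>y j\<close> is
  positive; if one of them vanishes, so does the product.\<close>

lemma weighted_arith_geom_mean:
  fixes y t :: "'j \<Rightarrow> real"
  assumes J: "finite J" and t: "\<And>j. j \<in> J \<Longrightarrow> 0 < t j" "(\<Sum>j\<in>J. t j) = 1"
    and y: "\<And>j. j \<in> J \<Longrightarrow> 0 \<le> y j"
  shows "(\<Prod>j\<in>J. y j powr t j) \<le> (\<Sum>j\<in>J. t j * y j)"
proof (cases "\<exists>j\<in>J. y j = 0")
  case True
  then have "(\<Prod>j\<in>J. y j powr t j) = 0"
    using J by (auto intro!: prod_zero)
  then show ?thesis
    using t y by (simp add: sum_nonneg less_imp_le)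
next
  case False
  then have pos: "\<And>j. j \<in> J \<Longrightarrow> 0 < y j"
    using y by fastforce
  have ne: "J \<noteq> {}"
    using t(2) by auto
  have *: "(\<Sum>j\<in>J. t j * ln (y j)) \<le> ln (\<Sum>j\<in>J. t j * y j)"
    using concave_on_sum[OF J ne ln_concave t(2), of y] pos t by (simp add: less_imp_le)
  have "0 < (\<Sum>j\<in>J. t j * y j)"
    by (intro sum_pos J ne mult_pos_pos t pos)
  moreover have "(\<Prod>j\<in>J. y j powr t j) = exp (\<Sum>j\<in>J. t j * ln (y j))"
    unfolding exp_sum[OF J] using pos by (intro prod.cong) (auto simp: powr_def order_less_imp_not_eq2)
  ultimately show ?thesis
    using * by (simp add: ln_ge_iff)
qed

text \<open>Dividing each \<open>h j\<close> by its total over \<open>A\<close> reduces the claim to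
  functions of sum one. For those, the weighted arithmetic-geometric mean inequality holds at every
  \<open>x\<close>, and its right side sums to the total of the weights.\<close>

lemma generalized_holder:
  fixes h :: "'j \<Rightarrow> 'i \<Rightarrow> real" and t :: "'j \<Rightarrow> real"
  assumes J: "finite J" and A: "finite A" and t: "\<And>j. j \<in> J \<Longrightarrow> 0 < t j" "(\<Sum>j\<in>J. t j) = 1"
    and h: "\<And>j x. j \<in> J \<Longrightarrow> x \<in> A \<Longrightarrow> 0 \<le> h j x"
  shows "(\<Sum>x\<in>A. \<Prod>j\<in>J. h j x powr t j) \<le> (\<Prod>j\<in>J. (\<Sum>x\<in>A. h j x) powr t j)"
proof (cases "\<exists>j\<in>J. (\<Sum>x\<in>A. h j x) = 0")
  case True
  then obtain j where j: "j \<in> J" "(\<Sum>x\<in>A. h j x) = 0" by blast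
  then have "\<And>x. x \<in> A \<Longrightarrow> h j x = 0"
    using h A by (subst (asm) sum_nonneg_eq_0_iff) auto
  then have "(\<Sum>x\<in>A. \<Prod>j\<in>J. h j x powr t j) = 0"
    using j J by (intro sum.neutral ballI prod_zero) auto
  then show ?thesis by (simp add: prod_nonneg)
next
  case False
  define H where "H j = (\<Sum>x\<in>A. h j x)" for j
  have H: "0 < H j" if "j \<in> J" for j
    using False that h unfolding H_def by (metis less_eq_real_def sum_nonneg)
  have "(\<Sum>x\<in>A. \<Prod>j\<in>J. h j x powr t j) = (\<Sum>x\<in>A. (\<Prod>j\<in>J. H j powr t j) * (\<Prod>j\<in>J. (h j x / H j) powr t j))"
    using H h by (intro sum.cong) (auto simp: powr_divide less_imp_le order_less_imp_not_eq2 simp flip: prod.distrib intro!: prod.cong)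
  also have "\<dots> \<le> (\<Sum>x\<in>A. (\<Prod>j\<in>J. H j powr t j) * (\<Sum>j\<in>J. t j * (h j x / H j)))"
    using H h t J by (intro sum_mono mult_left_mono weighted_arith_geom_mean prod_nonneg) (auto simp: less_imp_le)
  also have "\<dots> = (\<Prod>j\<in>J. H j powr t j) * (\<Sum>j\<in>J. t j * ((\<Sum>x\<in>A. h j x) / H j))"
    by (subst sum_divide_distrib, subst sum_distrib_left, subst sum.swap, subst sum_distrib_left) (rule refl)
  also have "(\<Sum>j\<in>J. t j * ((\<Sum>x\<in>A. h j x) / H j)) = (\<Sum>j\<in>J. t j)"
    using H by (intro sum.cong) (auto simp: H_def order_less_imp_not_eq2)
  finally show ?thesis using t by (simp add: H_def)
qed

lemma sum_PiE_insert:
  assumes "v \<notin> V"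
  shows "(\<Sum>i\<in>insert v V \<rightarrow>\<^sub>E I. F i) = (\<Sum>i\<in>V \<rightarrow>\<^sub>E I. \<Sum>x\<in>I. F (i(v := x)))"
proof -
  have "(\<Sum>i\<in>insert v V \<rightarrow>\<^sub>E I. F i) = (\<Sum>(x, i)\<in>I \<times> (V \<rightarrow>\<^sub>E I). F (i(v := x)))"
    unfolding PiE_insert_eq using inj_combinator[OF assms, of "\<lambda>_. I"]
    by (subst sum.reindex) (auto simp: case_prod_beta o_def)
  also have "\<dots> = (\<Sum>x\<in>I. \<Sum>i\<in>V \<rightarrow>\<^sub>E I. F (i(v := x)))"
    by (rule sum.cartesian_product[symmetric])
  finally show ?thesis
    by (subst sum.swap)
qed

lemma powr_inverse_power: "0 \<le> x \<Longrightarrow> 0 < d \<Longrightarrow> (x powr (1 / real d)) ^ d = x"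
  by (cases "x = 0") (auto simp: powr_powr simp flip: powr_realpow)

lemma power_powr_inverse: "0 \<le> x \<Longrightarrow> 0 < d \<Longrightarrow> (x ^ d) powr (1 / real d) = x"
  by (cases "x = 0") (auto simp: powr_powr simp flip: powr_realpow)

text \<open>Equal weights \<open>1 / d\<close>: the form in which Finner's inequality treats one
  coordinate.\<close>

lemma holder_uniform:
  fixes f :: "'j \<Rightarrow> 'i \<Rightarrow> real"
  assumes "finite J" "finite A" "card J = d" "0 < d"
    and f: "\<And>j x. j \<in> J \<Longrightarrow> x \<in> A \<Longrightarrow> 0 \<le> f j x"
  shows "(\<Sum>x\<in>A. \<Prod>j\<in>J. f j x) \<le> (\<Prod>j\<in>J. (\<Sum>x\<in>A. f j x ^ d) powr (1 / d))"
proof -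
  have "(\<Sum>x\<in>A. \<Prod>j\<in>J. f j x) = (\<Sum>x\<in>A. \<Prod>j\<in>J. (f j x ^ d) powr (1 / d))"
    using f \<open>0 < d\<close> by (intro sum.cong prod.cong refl) (simp add: power_powr_inverse)
  also have "\<dots> \<le> (\<Prod>j\<in>J. (\<Sum>x\<in>A. f j x ^ d) powr (1 / d))"
    using assms by (intro generalized_holder) auto
  finally show ?thesis .
qed

text \<open>Induction on the coordinates. With all coordinates other than \<open>v\<close> fixed,
  exactly \<open>d\<close> factors depend on \<open>v\<close>, so Hoelder's inequality with exponent
  \<open>d\<close> separates them, while the remaining factors are constants.\<close>

lemma finner:
  fixes f :: "'j \<Rightarrow> ('v \<Rightarrow> 'i) \<Rightarrow> real" and S :: "'j \<Rightarrow> 'v set"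
  assumes "finite V" "finite J" "finite I" "0 < d"
    and "\<And>j. j \<in> J \<Longrightarrow> S j \<subseteq> V"
    and "\<And>v. v \<in> V \<Longrightarrow> card {j \<in> J. v \<in> S j} = d"
    and "\<And>j u. j \<in> J \<Longrightarrow> 0 \<le> f j u"
  shows "(\<Sum>i\<in>V \<rightarrow>\<^sub>E I. \<Prod>j\<in>J. f j (restrict i (S j)))
    \<le> (\<Prod>j\<in>J. (\<Sum>u\<in>S j \<rightarrow>\<^sub>E I. f j u ^ d) powr (1 / d))"
  using assms(1,5,6,7)
proof (induction V arbitrary: S f rule: finite_induct)
  case empty
  then have "S j = {}" if "j \<in> J" for j using that by auto
  then show ?case using empty assms
    by (intro eq_refl) (auto intro!: prod.cong simp: power_powr_inverse restrict_def)
next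
  case (insert v V)
  define S' where "S' j = S j - {v}" for j
  \<comment> \<open>A factor that depends on \<open>v\<close> is replaced by its
    \<open>d\<close>-norm in that coordinate. The sum of the \<open>d\<close>-th powers of the new
    factor over \<open>S' j\<close> is then the original sum over \<open>S j\<close>.\<close>
  define f' where "f' j u = (if v \<in> S j then (\<Sum>x\<in>I. f j (u(v := x)) ^ d) powr (1 / d) else f j u)" for j u
  define K where "K = {j \<in> J. v \<in> S j}"
  have K: "K \<subseteq> J" "finite K" "card K = d"
    using insert.prems assms by (auto simp: K_def)
  have r1: "restrict (i(v := x)) (S j) = (restrict i (S' j))(v := x)" if "j \<in> K" for i :: "'v \<Rightarrow> 'i" and j x
    using that by (auto simp: K_def S'_def restrict_def)
  have r2: "restrict (i(v := x)) (S j) = restrict i (S' j)" if "j \<in> J - K" for i :: "'v \<Rightarrow> 'i" and j x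
    using that by (auto simp: K_def S'_def restrict_def)
  have inner: "(\<Sum>x\<in>I. \<Prod>j\<in>J. f j (restrict (i(v := x)) (S j))) \<le> (\<Prod>j\<in>J. f' j (restrict i (S' j)))" for i
  proof -
    have split: "(\<Prod>j\<in>J. g j) = (\<Prod>j\<in>J - K. g j) * (\<Prod>j\<in>K. g j)" for g :: "'j \<Rightarrow> real"
      by (rule prod.subset_diff[OF K(1) assms(2)])
    have "(\<Sum>x\<in>I. \<Prod>j\<in>J. f j (restrict (i(v := x)) (S j)))
      = (\<Prod>j\<in>J - K. f j (restrict i (S' j))) * (\<Sum>x\<in>I. \<Prod>j\<in>K. f j ((restrict i (S' j))(v := x)))"
      unfolding split sum_distrib_left using r1 r2 by (intro sum.cong arg_cong2[of _ _ _ _ "(*)"] prod.cong refl) auto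
    also have "\<dots> \<le> (\<Prod>j\<in>J - K. f j (restrict i (S' j)))
        * (\<Prod>j\<in>K. (\<Sum>x\<in>I. f j ((restrict i (S' j))(v := x)) ^ d) powr (1 / d))"
      using K insert.prems assms by (intro mult_left_mono holder_uniform prod_nonneg) auto
    also have "\<dots> = (\<Prod>j\<in>J. f' j (restrict i (S' j)))"
      unfolding split by (intro arg_cong2[of _ _ _ _ "(*)"] prod.cong refl) (auto simp: f'_def K_def)
    finally show ?thesis .
  qed
  have "(\<Sum>i\<in>insert v V \<rightarrow>\<^sub>E I. \<Prod>j\<in>J. f j (restrict i (S j)))
    \<le> (\<Sum>i\<in>V \<rightarrow>\<^sub>E I. \<Prod>j\<in>J. f' j (restrict i (S' j)))"
    unfolding sum_PiE_insert[OF insert.hyps(2)] by (intro sum_mono inner)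
  also have "\<dots> \<le> (\<Prod>j\<in>J. (\<Sum>u\<in>S' j \<rightarrow>\<^sub>E I. f' j u ^ d) powr (1 / d))"
  proof (rule insert.IH)
    show "card {j \<in> J. w \<in> S' j} = d" if "w \<in> V" for w
    proof -
      have "{j \<in> J. w \<in> S' j} = {j \<in> J. w \<in> S j}" using that insert.hyps by (auto simp: S'_def)
      then show ?thesis using insert.prems(2)[of w] that by simp
    qed
  qed (use insert.prems in \<open>auto simp: S'_def f'_def\<close>)
  also have "\<dots> = (\<Prod>j\<in>J. (\<Sum>u\<in>S j \<rightarrow>\<^sub>E I. f j u ^ d) powr (1 / d))"
  proof (intro prod.cong refl)
    fix j assume j: "j \<in> J"
    have "(\<Sum>u\<in>S' j \<rightarrow>\<^sub>E I. f' j u ^ d) = (\<Sum>u\<in>S j \<rightarrow>\<^sub>E I. f j u ^ d)"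
    proof (cases "v \<in> S j")
      case True
      then have "S j = insert v (S' j)" "v \<notin> S' j" by (auto simp: S'_def)
      then have "(\<Sum>u\<in>S j \<rightarrow>\<^sub>E I. f j u ^ d) = (\<Sum>u\<in>S' j \<rightarrow>\<^sub>E I. \<Sum>x\<in>I. f j (u(v := x)) ^ d)"
        by (simp add: sum_PiE_insert)
      also have "\<dots> = (\<Sum>u\<in>S' j \<rightarrow>\<^sub>E I. f' j u ^ d)"
        using True j insert.prems \<open>0 < d\<close>
        by (intro sum.cong refl) (simp add: f'_def powr_inverse_power sum_nonneg)
      finally show ?thesis ..
    qed (simp add: S'_def f'_def)
    then show "(\<Sum>u\<in>S' j \<rightarrow>\<^sub>E I. f' j u ^ d) powr (1 / d) = (\<Sum>u\<in>S j \<rightarrow>\<^sub>E I. f j u ^ d) powr (1 / d)"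
      by simp
  qed
  finally show ?case .
qed

section \<open>Blei's inequality by averaging over all \<open>k\<close>-element sets of
  coordinates\<close>

lemma powr_power_real: "0 < n \<Longrightarrow> (x powr u) ^ n = x powr (real n * u)" for x :: real
  by (cases "x = 0") (auto simp: powr_power)

text \<open>The count does not depend on \<open>v\<close>, which is the uniform covering condition
  of \<open>finner\<close> for the family of all \<open>k\<close>-subsets. It follows from the
  absorption identity for binomial coefficients.\<close>

lemma card_subsets_containing:
  assumes "finite V" "v \<in> V" "0 < k"
  shows "card V * card {S. S \<subseteq> V \<and> card S = k \<and> v \<in> S} = k * card {S. S \<subseteq> V \<and> card S = k}"
proof -
  have "{S. S \<subseteq> V \<and> card S = k \<and> v \<in> S} = insert v ` {T. T \<subseteq> V - {v} \<and> card T = k - 1}"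
  proof (intro set_eqI iffI)
    fix S assume "S \<in> {S. S \<subseteq> V \<and> card S = k \<and> v \<in> S}"
    then have "S = insert v (S - {v})" "S - {v} \<subseteq> V - {v}" "card (S - {v}) = k - 1"
      using assms by (auto simp: finite_subset card_Diff_singleton)
    then show "S \<in> insert v ` {T. T \<subseteq> V - {v} \<and> card T = k - 1}" by blast
  next
    fix S assume "S \<in> insert v ` {T. T \<subseteq> V - {v} \<and> card T = k - 1}"
    then obtain T where T: "S = insert v T" "T \<subseteq> V - {v}" "card T = k - 1" by auto
    then have "finite T" "v \<notin> T" using assms by (auto intro: finite_subset)
    then show "S \<in> {S. S \<subseteq> V \<and> card S = k \<and> v \<in> S}" using T assms by auto
  qed
  moreover have "inj_on (insert v) {T. T \<subseteq> V - {v} \<and> card T = k - 1}"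
    by (auto simp: inj_on_def)
  ultimately have "card {S. S \<subseteq> V \<and> card S = k \<and> v \<in> S} = (card V - 1) choose (k - 1)"
    using n_subsets[of "V - {v}" "k - 1"] assms by (simp add: card_image)
  then show ?thesis
    using n_subsets[of V k] times_binomial_minus1_eq[of k "card V"] assms by simp
qed

text \<open>
  The sum of \<open>a\<^sup>2\<close> over the coordinates outside \<open>S\<close> is \<open>s\<^sub>S\<close>. Write
  \<open>a\<^sup>\<rho> = (\<Prod>\<^sub>S w\<^sub>S)\<^bsup>\<beta>/N\<^esup> \<cdot> (\<Prod>\<^sub>S f\<^sub>S)\<^bsup>1-\<beta>\<^esup>\<close> with \<open>\<beta> = \<rho>/2\<close>, \<open>w\<^sub>S = a\<^sup>2 s\<^sub>S\<^bsup>(p-2)/2\<^esup>\<close> and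
  \<open>f\<^sub>S = s\<^sub>S\<^bsup>p/2d\<^esup>\<close>; the relation between \<open>\<rho>\<close> and \<open>p\<close> makes the powers of \<open>s\<^sub>S\<close> cancel.
  Hoelder's inequality separates the two products, and the second one is estimated by
  Finner's inequality.
\<close>

lemma blei:
  fixes a :: "('v \<Rightarrow> 'i) \<Rightarrow> real"
  assumes V: "finite V" "card V = m" and k: "0 < k" "k \<le> m" and I: "finite I"
    and p: "0 < p" "p < 2" and \<rho>: "0 < \<rho>" "1 / \<rho> - 1 / 2 = k / m * (1 / p - 1 / 2)"
    and a: "\<And>i. 0 \<le> a i"
    and B: "\<And>S. S \<subseteq> V \<Longrightarrow> card S = k \<Longrightarrow>
      (\<Sum>u\<in>S \<rightarrow>\<^sub>E I. (\<Sum>i\<in>{i \<in> V \<rightarrow>\<^sub>E I. restrict i S = u}. a i ^ 2) powr (p / 2)) \<le> B"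
  shows "(\<Sum>i\<in>V \<rightarrow>\<^sub>E I. a i powr \<rho>) \<le> B powr (\<rho> / p)"
proof -
  define J where "J = {S. S \<subseteq> V \<and> card S = k}"
  define N where "N = card J"
  \<comment> \<open>The number of \<open>k\<close>-subsets through a given point; \<open>dv'\<close>
    shows that the division is exact.\<close>
  define d where "d = N * k div m"
  have m: "0 < m" using k by simp
  have J: "finite J" using V by (auto simp: J_def)
  have Npos: "0 < N"
    using n_subsets[of V k] V k by (simp add: N_def J_def zero_less_binomial)
  have dv: "m * card {S \<in> J. v \<in> S} = k * N" if "v \<in> V" for v
    using card_subsets_containing[OF V(1) that k(1)] V by (simp add: J_def N_def conj_assoc)
  have dv': "card {S \<in> J. v \<in> S} = d" if "v \<in> V" for v
  proof -
    have "d = m * card {S \<in> J. v \<in> S} div m" unfolding dv[OF that] d_def by (simp add: mult.commute)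
    then show ?thesis using m by simp
  qed
  obtain v0 where "v0 \<in> V" using V m by fastforce
  have d: "m * d = k * N" using dv[OF \<open>v0 \<in> V\<close>] dv'[OF \<open>v0 \<in> V\<close>] by simp
  have dpos: "0 < d" using d k Npos m by (metis mult_is_0 not_gr_zero)
  have dr: "real m * real d = real k * real N" using d by (metis of_nat_mult)
  define \<beta> where "\<beta> = \<rho> / 2"
  have frac: "k * (2 - p) * \<rho> = m * p * (2 - \<rho>)"
    using \<rho> p m by (simp add: field_simps)
  have \<rho>2: "\<rho> < 2"
  proof (rule ccontr)
    assume "\<not> \<rho> < 2"
    then have "m * p * (2 - \<rho>) \<le> 0" using p m by (simp add: mult_nonneg_nonpos)
    moreover have "0 < k * (2 - p) * \<rho>" using k p \<rho> by simp
    ultimately show False using frac by simp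
  qed
  have \<beta>: "0 < \<beta>" "\<beta> < 1" using \<rho> \<rho>2 by (auto simp: \<beta>_def)
  define s where "s S u = (\<Sum>i\<in>{i \<in> V \<rightarrow>\<^sub>E I. restrict i S = u}. a i ^ 2)" for S u
  have s0: "0 \<le> s S u" for S u by (simp add: s_def sum_nonneg)
  have fin: "finite (V \<rightarrow>\<^sub>E I)" using V I by (simp add: finite_PiE)
  define w where "w S i = a i ^ 2 * s S (restrict i S) powr ((p - 2) / 2)" for S i
  define f where "f S u = s S u powr (p / (2 * d))" for S u
  have w0: "0 \<le> w S i" and f0: "0 \<le> f S u" for S i u
    by (auto simp: w_def f_def)
  have fd: "f S u ^ d = s S u powr (p / 2)" for S u
    using dpos by (simp add: f_def powr_power_real)
  have "0 \<le> B"
  proof -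
    obtain S where "S \<subseteq> V" "card S = k"
      using V k obtain_subset_with_card_n by metis
    from B[OF this] show ?thesis by (rule order_trans[rotated]) (auto intro!: sum_nonneg)
  qed
  have sB: "(\<Sum>u\<in>S \<rightarrow>\<^sub>E I. s S u powr (p / 2)) \<le> B" if "S \<in> J" for S
    using B that by (auto simp: J_def s_def)
  have wB: "(\<Sum>i\<in>V \<rightarrow>\<^sub>E I. w S i) \<le> B" if "S \<in> J" for S
  proof -
    have SV: "S \<subseteq> V" using that by (simp add: J_def)
    then have finS: "finite (S \<rightarrow>\<^sub>E I)" using V I by (auto intro!: finite_PiE intro: finite_subset)
    have "(\<Sum>i\<in>V \<rightarrow>\<^sub>E I. w S i) = (\<Sum>u\<in>S \<rightarrow>\<^sub>E I. \<Sum>i\<in>{i \<in> V \<rightarrow>\<^sub>E I. restrict i S = u}. w S i)"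
      by (rule sum.group[symmetric, OF fin finS]) (use SV in auto)
    also have "\<dots> = (\<Sum>u\<in>S \<rightarrow>\<^sub>E I. s S u * s S u powr ((p - 2) / 2))"
      by (intro sum.cong refl) (simp add: w_def s_def sum_distrib_right)
    also have "\<dots> = (\<Sum>u\<in>S \<rightarrow>\<^sub>E I. s S u powr (p / 2))"
    proof (intro sum.cong refl)
      fix u
      show "s S u * s S u powr ((p - 2) / 2) = s S u powr (p / 2)"
      proof (cases "s S u = 0")
        case False
        then have "0 < s S u" using s0[of S u] by simp
        then have "s S u * s S u powr ((p - 2) / 2) = s S u powr (1 + (p - 2) / 2)"
          by (subst powr_add) simp
        also have "1 + (p - 2) / 2 = p / 2" by (simp add: field_simps)
        finally show ?thesis .
      qed simp
    qed
    finally show ?thesis using sB[OF that] by simp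
  qed
  have fB: "(\<Sum>i\<in>V \<rightarrow>\<^sub>E I. \<Prod>S\<in>J. f S (restrict i S)) \<le> B powr (N / d)"
  proof -
    have "(\<Sum>i\<in>V \<rightarrow>\<^sub>E I. \<Prod>S\<in>J. f S (restrict i S)) \<le> (\<Prod>S\<in>J. (\<Sum>u\<in>S \<rightarrow>\<^sub>E I. f S u ^ d) powr (1 / d))"
      by (rule finner[OF V(1) J I dpos]) (use dv' f0 in \<open>auto simp: J_def\<close>)
    also have "\<dots> \<le> (\<Prod>S\<in>J. B powr (1 / d))"
      unfolding fd by (intro prod_mono conjI powr_mono2 sB) (auto intro!: sum_nonneg)
    also have "\<dots> = B powr (N / d)"
      using Npos by (simp add: N_def powr_power_real)
    finally show ?thesis .
  qed
  \<comment> \<open>\<open>None\<close> carries the product of the \<open>f S\<close> with weight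
    \<open>1 - \<beta>\<close>, and each \<open>Some S\<close> carries \<open>w S\<close> with
    weight \<open>\<beta> / N\<close>; the weights sum to one.\<close>
  define h where "h j i = (case j of None \<Rightarrow> (\<Prod>S\<in>J. f S (restrict i S)) | Some S \<Rightarrow> w S i)" for j i
  define t where "t j = (case j of None \<Rightarrow> 1 - \<beta> | Some (S :: 'v set) \<Rightarrow> \<beta> / N)" for j
  let ?J = "insert None (Some ` J)"
  have prodJ: "(\<Prod>j\<in>?J. g j) = g None * (\<Prod>S\<in>J. g (Some S))" for g :: "_ \<Rightarrow> real"
    using J by (simp add: prod.reindex)
  have sumJ: "(\<Sum>j\<in>?J. t j) = 1"
    using J Npos by (auto simp: sum.reindex t_def N_def)
  have exps: "(p - 2) / 2 * (\<beta> / N) + p / (2 * d) * (1 - \<beta>) = 0"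
  proof -
    have "m * (N * p * (2 - \<rho>)) = N * (m * p * (2 - \<rho>))" by simp
    also have "\<dots> = (k * N) * ((2 - p) * \<rho>)" unfolding frac[symmetric] by simp
    also have "\<dots> = m * (d * (2 - p) * \<rho>)" using dr by simp
    finally have "m * (N * p * (2 - \<rho>)) = m * (d * (2 - p) * \<rho>)" .
    then have "N * p * (2 - \<rho>) = d * (2 - p) * \<rho>" using m by simp
    then show ?thesis using Npos dpos by (simp add: \<beta>_def field_simps)
  qed
  have a_le: "a i powr \<rho> \<le> (\<Prod>j\<in>?J. h j i powr t j)" if i: "i \<in> V \<rightarrow>\<^sub>E I" for i
  proof (cases "a i = 0")
    case True
    then show ?thesis using \<rho> by (simp add: prod_nonneg)
  next
    case False
    then have ai: "0 < a i" using a[of i] by simp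
    \<comment> \<open>Since \<open>0 powr 0 = 0\<close>, cancelling the exponents of
      \<open>s\<close> requires a positive base. The fibre through \<open>i\<close> contains
      \<open>i\<close> itself, where \<open>a\<close> is positive.\<close>
    have spos: "0 < s S (restrict i S)" for S
      unfolding s_def using ai i fin by (intro sum_pos2[of _ i]) auto
    have "(\<Prod>j\<in>?J. h j i powr t j)
      = (\<Prod>S\<in>J. s S (restrict i S) powr (p / (2 * d))) powr (1 - \<beta>)
        * (\<Prod>S\<in>J. (a i ^ 2 * s S (restrict i S) powr ((p - 2) / 2)) powr (\<beta> / N))"
      unfolding prodJ by (simp add: h_def t_def w_def f_def)
    also have "\<dots> = (\<Prod>S\<in>J. (s S (restrict i S) powr (p / (2 * d))) powr (1 - \<beta>)
        * (a i ^ 2 * s S (restrict i S) powr ((p - 2) / 2)) powr (\<beta> / N))"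
      by (simp add: prod_powr_distrib prod.distrib)
    also have "\<dots> = (\<Prod>S\<in>J. a i powr (\<rho> / N))"
    proof (intro prod.cong refl)
      fix S
      have "(s S (restrict i S) powr (p / (2 * d))) powr (1 - \<beta>)
          * (a i ^ 2 * s S (restrict i S) powr ((p - 2) / 2)) powr (\<beta> / N)
        = (a i ^ 2) powr (\<beta> / N)
          * s S (restrict i S) powr ((p - 2) / 2 * (\<beta> / N) + p / (2 * d) * (1 - \<beta>))"
        by (simp add: powr_mult powr_powr powr_add)
      also have "\<dots> = (a i ^ 2) powr (\<beta> / N)"
        unfolding exps using spos[of S] by (simp add: powr_def)
      also have "\<dots> = a i powr (\<rho> / N)"
        using ai by (simp add: powr_powr \<beta>_def flip: powr_numeral)
      finally show "(s S (restrict i S) powr (p / (2 * d))) powr (1 - \<beta>)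
          * (a i ^ 2 * s S (restrict i S) powr ((p - 2) / 2)) powr (\<beta> / N) = a i powr (\<rho> / N)" .
    qed
    also have "\<dots> = a i powr \<rho>"
      using Npos by (simp add: N_def[symmetric] powr_power_real)
    finally show ?thesis by simp
  qed
  have "(\<Sum>i\<in>V \<rightarrow>\<^sub>E I. a i powr \<rho>) \<le> (\<Sum>i\<in>V \<rightarrow>\<^sub>E I. \<Prod>j\<in>?J. h j i powr t j)"
    by (intro sum_mono a_le)
  also have "\<dots> \<le> (\<Prod>j\<in>?J. (\<Sum>i\<in>V \<rightarrow>\<^sub>E I. h j i) powr t j)"
    using J fin sumJ \<beta> Npos w0 f0
    by (intro generalized_holder) (auto simp: h_def t_def intro!: prod_nonneg)
  also have "\<dots> = (\<Sum>i\<in>V \<rightarrow>\<^sub>E I. \<Prod>S\<in>J. f S (restrict i S)) powr (1 - \<beta>)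
      * (\<Prod>S\<in>J. (\<Sum>i\<in>V \<rightarrow>\<^sub>E I. w S i) powr (\<beta> / N))"
    unfolding prodJ by (simp add: h_def t_def)
  also have "\<dots> \<le> (B powr (N / d)) powr (1 - \<beta>) * (\<Prod>S\<in>J. B powr (\<beta> / N))"
    using \<beta> fB wB w0 f0
    by (intro mult_mono powr_mono2 prod_mono conjI) (auto intro!: sum_nonneg prod_nonneg)
  also have "\<dots> = B powr (N / d * (1 - \<beta>) + \<beta>)"
    using Npos by (simp add: powr_powr powr_add N_def[symmetric] powr_power_real)
  also have "N / d * (1 - \<beta>) + \<beta> = \<rho> / p"
  proof -
    have Nd: "N / d = m / k" using dr k dpos by (simp add: field_simps)
    have "k * p * \<rho> + m * p * (2 - \<rho>) = 2 * k * \<rho>" unfolding frac[symmetric] by (simp add: algebra_simps)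
    then show ?thesis unfolding Nd \<beta>_def using k p by (simp add: field_simps)
  qed
  finally show ?thesis .
qed

section \<open>Monomials on roots of unity\<close>

definition monomial :: "nat \<Rightarrow> (nat \<Rightarrow> nat) \<Rightarrow> (nat \<Rightarrow> complex) \<Rightarrow> complex"
  where "monomial n \<alpha> z = (\<Prod>i<n. z i ^ \<alpha> i)"

text \<open>The restriction to \<open>{..<n}\<close> keeps the sum extensional, so that it is again
  an element of some \<open>multi_indices n m\<close>.\<close>

definition index_add :: "nat \<Rightarrow> (nat \<Rightarrow> nat) \<Rightarrow> (nat \<Rightarrow> nat) \<Rightarrow> nat \<Rightarrow> nat"
  where "index_add n \<alpha> \<beta> = (\<lambda>i\<in>{..<n}. \<alpha> i + \<beta> i)"

text \<open>
  Averages over \<open>N\<close>-th roots of unity replace integrals over the torus: monomials of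
  degree less than \<open>N\<close> in each variable are orthogonal.
\<close>

definition torus :: "nat \<Rightarrow> nat \<Rightarrow> (nat \<Rightarrow> complex) set"
  where "torus N n = {..<n} \<rightarrow>\<^sub>E {u. u ^ N = 1}"

lemma multi_indices_le: "\<alpha> \<in> multi_indices n m \<Longrightarrow> i < n \<Longrightarrow> \<alpha> i \<le> m"
  using member_le_sum[of i "{..<n}" \<alpha>] by (simp add: multi_indices_def)

lemma finite_multi_indices [simp]: "finite (multi_indices n m)"
proof (rule finite_subset)
  show "multi_indices n m \<subseteq> {..<n} \<rightarrow>\<^sub>E {..m}"
  proof
    fix \<alpha> assume \<alpha>: "\<alpha> \<in> multi_indices n m"
    then have "\<alpha> \<in> extensional {..<n}" by (simp add: multi_indices_def PiE_iff)
    then show "\<alpha> \<in> {..<n} \<rightarrow>\<^sub>E {..m}" using multi_indices_le[OF \<alpha>] by (simp add: PiE_iff)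
  qed
qed (simp add: finite_PiE)

lemma multi_indices_eqI:
  "\<alpha> \<in> multi_indices n m \<Longrightarrow> \<beta> \<in> multi_indices n m' \<Longrightarrow> (\<And>i. i < n \<Longrightarrow> \<alpha> i = \<beta> i) \<Longrightarrow> \<alpha> = \<beta>"
  by (rule PiE_ext[of \<alpha> "{..<n}" "\<lambda>_. UNIV"]) (simp_all only: multi_indices_def mem_Collect_eq lessThan_iff)

lemma index_add_mem:
  "\<alpha> \<in> multi_indices n k \<Longrightarrow> \<beta> \<in> multi_indices n l \<Longrightarrow> index_add n \<alpha> \<beta> \<in> multi_indices n (k + l)"
  by (simp add: multi_indices_def index_add_def sum.distrib)

lemma monomial_index_add: "monomial n (index_add n \<alpha> \<beta>) z = monomial n \<alpha> z * monomial n \<beta> z"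
  by (simp add: monomial_def index_add_def power_add prod.distrib)

lemma finite_torus [simp]: "0 < N \<Longrightarrow> finite (torus N n)"
  by (simp add: torus_def finite_PiE finite_roots_unity)

lemma card_torus: "0 < N \<Longrightarrow> card (torus N n) = N ^ n"
  by (simp add: torus_def card_PiE card_roots_unity_eq)

lemma norm_root_of_unity: "u ^ N = 1 \<Longrightarrow> 0 < N \<Longrightarrow> cmod u = 1"
  by (rule power_eq_imp_eq_base[of _ N]) (simp_all only: norm_power[symmetric] norm_one power_one norm_ge_zero zero_le_one)

lemma norm_torus: "z \<in> torus N n \<Longrightarrow> 0 < N \<Longrightarrow> i < n \<Longrightarrow> cmod (z i) = 1"
  by (rule norm_root_of_unity[of _ N]) (simp_all add: torus_def PiE_iff)

text \<open>Multiplication by the primitive root \<open>\<omega> 1\<close> permutes the roots and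
  multiplies the sum by \<open>\<omega> 1 ^ a * cnj (\<omega> 1 ^ b)\<close>. For distinct exponents
  below \<open>N\<close> this factor is not one, so the sum vanishes.\<close>

lemma sum_roots_of_unity_orthogonal:
  assumes "a < N" "b < N"
  shows "(\<Sum>u\<in>{u::complex. u ^ N = 1}. u ^ a * cnj (u ^ b)) = (if a = b then of_nat N else 0)"
proof (cases "a = b")
  case True
  have "u ^ a * cnj (u ^ a) = 1" if "u ^ N = 1" for u :: complex
  proof -
    have "cmod u = 1" using that assms norm_root_of_unity by auto
    then show ?thesis by (simp add: power_mult_distrib[symmetric] complex_norm_square[symmetric])
  qed
  then show ?thesis using True assms card_roots_unity_eq[of N] by simp
next
  case False
  define \<omega> where "\<omega> j = cis (2 * pi * real j / real N)" for j
  have bij: "bij_betw \<omega> {..<N} {u. u ^ N = 1}"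
    using Complex.bij_betw_roots_unity[of N] assms unfolding \<omega>_def by simp
  have pow: "\<omega> 1 ^ j = \<omega> j" for j by (simp add: \<omega>_def Complex.DeMoivre mult_ac)
  have \<omega>1: "\<omega> 1 ^ N = 1" "\<omega> 1 \<noteq> 0" using assms by (auto simp: \<omega>_def Complex.DeMoivre)
  let ?S = "\<Sum>u\<in>{u::complex. u ^ N = 1}. u ^ a * cnj (u ^ b)"
  have "?S = (\<Sum>u\<in>{u::complex. u ^ N = 1}. (\<omega> 1 * u) ^ a * cnj ((\<omega> 1 * u) ^ b))"
  proof (rule sum.reindex_bij_witness[where i = "\<lambda>u. \<omega> 1 * u" and j = "\<lambda>u. u / \<omega> 1"])
  qed (use \<omega>1 in \<open>auto simp: power_mult_distrib power_divide\<close>)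
  also have "\<dots> = \<omega> 1 ^ a * cnj (\<omega> 1 ^ b) * ?S"
    by (simp add: sum_distrib_left power_mult_distrib mult_ac)
  finally have "?S = 0 \<or> \<omega> 1 ^ a * cnj (\<omega> 1 ^ b) = 1" by auto
  moreover have "\<omega> 1 ^ a * cnj (\<omega> 1 ^ b) \<noteq> 1"
  proof
    assume *: "\<omega> 1 ^ a * cnj (\<omega> 1 ^ b) = 1"
    have "cnj (\<omega> 1 ^ b) * \<omega> 1 ^ b = 1"
      unfolding pow by (simp add: \<omega>_def cis_cnj cis_mult)
    then have "\<omega> a = \<omega> b"
      using * unfolding pow by (metis mult.assoc mult.left_neutral mult.right_neutral)
    then show False using bij assms False by (auto simp: bij_betw_def inj_on_def)
  qed
  ultimately show ?thesis using False by simp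
qed

lemma monomial_orthogonal:
  assumes "\<And>i. i < n \<Longrightarrow> \<alpha> i < N" "\<And>i. i < n \<Longrightarrow> \<beta> i < N" "0 < N"
  shows "(\<Sum>z\<in>torus N n. monomial n \<alpha> z * cnj (monomial n \<beta> z))
    = (if \<forall>i<n. \<alpha> i = \<beta> i then of_nat (N ^ n) else 0)"
proof -
  have "(\<Sum>z\<in>torus N n. monomial n \<alpha> z * cnj (monomial n \<beta> z))
    = (\<Sum>z\<in>torus N n. \<Prod>i<n. z i ^ \<alpha> i * cnj (z i ^ \<beta> i))"
    by (simp add: monomial_def prod.distrib)
  also have "\<dots> = (\<Prod>i<n. \<Sum>u\<in>{u. u ^ N = 1}. u ^ \<alpha> i * cnj (u ^ \<beta> i))"
    unfolding torus_def by (subst prod_sum_PiE) (use assms in \<open>auto simp: finite_roots_unity\<close>)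
  also have "\<dots> = (\<Prod>i<n. if \<alpha> i = \<beta> i then of_nat N else 0)"
    using assms by (intro prod.cong refl sum_roots_of_unity_orthogonal) auto
  also have "\<dots> = (if \<forall>i<n. \<alpha> i = \<beta> i then of_nat (N ^ n) else 0)"
    by (auto simp: prod_zero_iff)
  finally show ?thesis .
qed

text \<open>All exponents are at most \<open>d < N\<close>, so distinct monomials do not coincide on
  the roots of unity and orthogonality applies.\<close>

lemma torus_parseval:
  assumes \<Gamma>: "\<Gamma> \<subseteq> multi_indices n d" and N: "d < N"
  shows "(\<Sum>z\<in>torus N n. (cmod (\<Sum>\<gamma>\<in>\<Gamma>. a \<gamma> * monomial n \<gamma> z))\<^sup>2) = real N ^ n * (\<Sum>\<gamma>\<in>\<Gamma>. (cmod (a \<gamma>))\<^sup>2)"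
proof -
  have fin: "finite \<Gamma>" using \<Gamma> finite_subset finite_multi_indices by blast
  have "complex_of_real (\<Sum>z\<in>torus N n. (cmod (\<Sum>\<gamma>\<in>\<Gamma>. a \<gamma> * monomial n \<gamma> z))\<^sup>2)
    = (\<Sum>z\<in>torus N n. \<Sum>\<gamma>\<in>\<Gamma>. \<Sum>\<delta>\<in>\<Gamma>. a \<gamma> * cnj (a \<delta>) * (monomial n \<gamma> z * cnj (monomial n \<delta> z)))"
    by (simp only: of_real_sum complex_norm_square cnj_sum sum_product complex_cnj_mult mult_ac)
  also have "\<dots> = (\<Sum>\<gamma>\<in>\<Gamma>. \<Sum>\<delta>\<in>\<Gamma>. a \<gamma> * cnj (a \<delta>) * (\<Sum>z\<in>torus N n. monomial n \<gamma> z * cnj (monomial n \<delta> z)))"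
    by (subst sum.swap, intro sum.cong refl, subst sum.swap) (simp add: sum_distrib_left)
  also have "\<dots> = (\<Sum>\<gamma>\<in>\<Gamma>. \<Sum>\<delta>\<in>\<Gamma>. if \<gamma> = \<delta> then a \<gamma> * cnj (a \<gamma>) * of_nat (N ^ n) else 0)"
  proof (intro sum.cong refl)
    fix \<gamma> \<delta> assume *: "\<gamma> \<in> \<Gamma>" "\<delta> \<in> \<Gamma>"
    then have **: "\<gamma> \<in> multi_indices n d" "\<delta> \<in> multi_indices n d" using \<Gamma> by auto
    then have "(\<forall>i<n. \<gamma> i = \<delta> i) \<longleftrightarrow> \<gamma> = \<delta>" using multi_indices_eqI by blast
    moreover have "\<And>i. i < n \<Longrightarrow> \<gamma> i < N" "\<And>i. i < n \<Longrightarrow> \<delta> i < N"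
      using multi_indices_le[OF **(1)] multi_indices_le[OF **(2)] N by fastforce+
    ultimately show "a \<gamma> * cnj (a \<delta>) * (\<Sum>z\<in>torus N n. monomial n \<gamma> z * cnj (monomial n \<delta> z))
      = (if \<gamma> = \<delta> then a \<gamma> * cnj (a \<gamma>) * of_nat (N ^ n) else 0)"
      using N by (simp add: monomial_orthogonal)
  qed
  also have "\<dots> = complex_of_real (real N ^ n * (\<Sum>\<gamma>\<in>\<Gamma>. (cmod (a \<gamma>))\<^sup>2))"
    using fin by (simp only: sum.delta if_True of_real_mult of_real_sum complex_norm_square sum_distrib_left) (simp add: mult_ac cong: sum.cong)
  finally show ?thesis using of_real_eq_iff by blast
qed

text \<open>The first summand determines the second and is bounded by \<open>\<delta>\<close> in
  each coordinate. So there are at most as many decompositions as the product of the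
  \<open>\<delta> i + 1\<close>, and \<open>\<delta> i + 1 \<le> 2 ^ \<delta> i\<close>.\<close>

lemma card_index_decompositions:
  assumes \<Gamma>: "\<Gamma> \<subseteq> multi_indices n d" and \<delta>: "\<delta> \<in> multi_indices n (2 * d)"
  shows "card {(\<gamma>, \<gamma>'). (\<gamma>, \<gamma>') \<in> \<Gamma> \<times> \<Gamma> \<and> index_add n \<gamma> \<gamma>' = \<delta>} \<le> 4 ^ d"
proof -
  let ?A = "{(\<gamma>, \<gamma>'). (\<gamma>, \<gamma>') \<in> \<Gamma> \<times> \<Gamma> \<and> index_add n \<gamma> \<gamma>' = \<delta>}"
  let ?P = "\<Pi>\<^sub>E i\<in>{..<n}. {..\<delta> i}"
  have "inj_on fst ?A"
  proof (rule inj_onI)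
    fix x y assume *: "x \<in> ?A" "y \<in> ?A" "fst x = fst y"
    obtain \<gamma> \<gamma>' \<eta>' where xy: "x = (\<gamma>, \<gamma>')" "y = (\<gamma>, \<eta>')" using * by (cases x; cases y) auto
    have "\<gamma>' i = \<eta>' i" if "i < n" for i
      using * that xy by (auto simp: index_add_def dest!: fun_cong[where x = i])
    moreover have "\<gamma>' \<in> multi_indices n d" "\<eta>' \<in> multi_indices n d" using * xy \<Gamma> by auto
    ultimately show "x = y" using xy multi_indices_eqI by blast
  qed
  moreover have "fst ` ?A \<subseteq> ?P"
  proof
    fix \<gamma> assume "\<gamma> \<in> fst ` ?A"
    then obtain \<gamma>' where *: "\<gamma> \<in> \<Gamma>" "index_add n \<gamma> \<gamma>' = \<delta>" by auto
    then have "\<gamma> \<in> extensional {..<n}" using \<Gamma> by (auto simp: multi_indices_def PiE_iff)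
    then show "\<gamma> \<in> ?P" using *(2) by (auto simp: PiE_iff index_add_def)
  qed
  ultimately have "card ?A \<le> card ?P"
    by (intro card_inj_on_le[of fst]) (auto simp: finite_PiE)
  also have "card ?P = (\<Prod>i<n. \<delta> i + 1)" by (simp add: card_PiE)
  also have "\<dots> \<le> (\<Prod>i<n. 2 ^ \<delta> i)"
    by (intro prod_mono) (auto simp: Suc_leI less_exp)
  also have "\<dots> = 2 ^ (2 * d)" using \<delta> by (simp add: power_sum[symmetric] multi_indices_def)
  finally show ?thesis by (simp add: power_mult)
qed

text \<open>The fourth moment is the second moment of the square, a polynomial of degree
  \<open>2 * d\<close>, to which Parseval applies because \<open>2 * d < N\<close>. Each of its
  coefficients is a sum over at most \<open>4 ^ d\<close> decompositions, and Cauchy-Schwarz costs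
  this number.\<close>

lemma torus_fourth_moment:
  assumes \<Gamma>: "\<Gamma> \<subseteq> multi_indices n d" and N: "2 * d < N"
  shows "(\<Sum>z\<in>torus N n. (cmod (\<Sum>\<gamma>\<in>\<Gamma>. a \<gamma> * monomial n \<gamma> z)) ^ 4)
    \<le> real N ^ n * 4 ^ d * (\<Sum>\<gamma>\<in>\<Gamma>. (cmod (a \<gamma>))\<^sup>2)\<^sup>2"
proof -
  have fin: "finite \<Gamma>" using \<Gamma> finite_subset finite_multi_indices by blast
  let ?\<Delta> = "multi_indices n (2 * d)"
  define A where "A \<delta> = {(\<gamma>, \<gamma>'). (\<gamma>, \<gamma>') \<in> \<Gamma> \<times> \<Gamma> \<and> index_add n \<gamma> \<gamma>' = \<delta>}" for \<delta>
  have A: "A \<delta> = {x \<in> \<Gamma> \<times> \<Gamma>. (case x of (\<gamma>, \<gamma>') \<Rightarrow> index_add n \<gamma> \<gamma>') = \<delta>}" for \<delta>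
    by (auto simp: A_def)
  have group: "(\<Sum>x\<in>\<Gamma> \<times> \<Gamma>. F x) = (\<Sum>\<delta>\<in>?\<Delta>. \<Sum>x\<in>A \<delta>. F x)" for F :: "_ \<Rightarrow> 'b::comm_monoid_add"
    unfolding A using \<Gamma> fin index_add_mem[of _ n d _ d]
    by (intro sum.group[symmetric]) (auto simp: mult_2)
  define b where "b \<delta> = (\<Sum>(\<gamma>, \<gamma>')\<in>A \<delta>. a \<gamma> * a \<gamma>')" for \<delta>
  have sq: "(\<Sum>\<gamma>\<in>\<Gamma>. a \<gamma> * monomial n \<gamma> z)\<^sup>2 = (\<Sum>\<delta>\<in>?\<Delta>. b \<delta> * monomial n \<delta> z)" for z
  proof -
    have "(\<Sum>\<gamma>\<in>\<Gamma>. a \<gamma> * monomial n \<gamma> z)\<^sup>2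
      = (\<Sum>(\<gamma>, \<gamma>')\<in>\<Gamma> \<times> \<Gamma>. a \<gamma> * a \<gamma>' * monomial n (index_add n \<gamma> \<gamma>') z)"
      by (simp add: power2_eq_square sum_product sum.cartesian_product monomial_index_add mult_ac)
    also have "\<dots> = (\<Sum>\<delta>\<in>?\<Delta>. b \<delta> * monomial n \<delta> z)"
      unfolding group b_def sum_distrib_right by (intro sum.cong refl) (auto simp: A_def)
    finally show ?thesis .
  qed
  have bb: "(cmod (b \<delta>))\<^sup>2 \<le> 4 ^ d * (\<Sum>(\<gamma>, \<gamma>')\<in>A \<delta>. (cmod (a \<gamma>))\<^sup>2 * (cmod (a \<gamma>'))\<^sup>2)"
    if "\<delta> \<in> ?\<Delta>" for \<delta>
  proof -
    have "(cmod (b \<delta>))\<^sup>2 \<le> (\<Sum>(\<gamma>, \<gamma>')\<in>A \<delta>. 1 * (cmod (a \<gamma>) * cmod (a \<gamma>')))\<^sup>2"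
      unfolding b_def by (intro power_mono order_trans[OF norm_sum] sum_mono) (auto simp: norm_mult)
    also have "\<dots> \<le> (\<Sum>x\<in>A \<delta>. 1\<^sup>2) * (\<Sum>(\<gamma>, \<gamma>')\<in>A \<delta>. (cmod (a \<gamma>) * cmod (a \<gamma>'))\<^sup>2)"
      using Cauchy_Schwarz_ineq_sum[of "\<lambda>_. 1" "\<lambda>(\<gamma>, \<gamma>'). cmod (a \<gamma>) * cmod (a \<gamma>')" "A \<delta>"]
      by (simp add: case_prod_beta)
    also have "\<dots> \<le> 4 ^ d * (\<Sum>(\<gamma>, \<gamma>')\<in>A \<delta>. (cmod (a \<gamma>) * cmod (a \<gamma>'))\<^sup>2)"
    proof (rule mult_right_mono)
      have "real (card (A \<delta>)) \<le> real (4 ^ d)"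
        unfolding of_nat_le_iff A_def by (rule card_index_decompositions[OF \<Gamma> that])
      then show "(\<Sum>x\<in>A \<delta>. 1\<^sup>2) \<le> (4 ^ d :: real)" by simp
    qed (auto intro!: sum_nonneg)
    finally show ?thesis by (simp add: power_mult_distrib)
  qed
  have "(\<Sum>z\<in>torus N n. (cmod (\<Sum>\<gamma>\<in>\<Gamma>. a \<gamma> * monomial n \<gamma> z)) ^ 4)
    = (\<Sum>z\<in>torus N n. (cmod ((\<Sum>\<gamma>\<in>\<Gamma>. a \<gamma> * monomial n \<gamma> z)\<^sup>2))\<^sup>2)"
    by (simp add: norm_power)
  also have "\<dots> = real N ^ n * (\<Sum>\<delta>\<in>?\<Delta>. (cmod (b \<delta>))\<^sup>2)"
    unfolding sq using torus_parseval[OF order_refl N, where a = b] by simp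
  also have "\<dots> \<le> real N ^ n * (\<Sum>\<delta>\<in>?\<Delta>. 4 ^ d * (\<Sum>(\<gamma>, \<gamma>')\<in>A \<delta>. (cmod (a \<gamma>))\<^sup>2 * (cmod (a \<gamma>'))\<^sup>2))"
    by (intro mult_left_mono sum_mono bb) auto
  also have "\<dots> = real N ^ n * 4 ^ d * (\<Sum>(\<gamma>, \<gamma>')\<in>\<Gamma> \<times> \<Gamma>. (cmod (a \<gamma>))\<^sup>2 * (cmod (a \<gamma>'))\<^sup>2)"
    unfolding group by (simp add: sum_distrib_left mult_ac)
  also have "\<dots> = real N ^ n * 4 ^ d * (\<Sum>\<gamma>\<in>\<Gamma>. (cmod (a \<gamma>))\<^sup>2)\<^sup>2"
    by (simp add: power2_eq_square sum_product sum.cartesian_product)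
  finally show ?thesis .
qed

section \<open>Hypercontractivity in 2-convex and 2-concave function spaces\<close>

text \<open>Hoelder bounds the second moment by the \<open>p\<close>-th and fourth ones. Inserting
  the assumed bound on the fourth moment leaves powers of the second moment on both sides, and the
  inequality is solved for it.\<close>

lemma moment_interpolation:
  fixes g :: "'z \<Rightarrow> real"
  assumes Z: "finite Z" "Z \<noteq> {}" and p: "0 < p" "p < 2" and g: "\<And>z. z \<in> Z \<Longrightarrow> 0 \<le> g z"
    and K: "0 \<le> K" "(\<Sum>z\<in>Z. g z ^ 4) / card Z \<le> K * ((\<Sum>z\<in>Z. (g z)\<^sup>2) / card Z)\<^sup>2"
  shows "((\<Sum>z\<in>Z. (g z)\<^sup>2) / card Z) powr (p / 2)
    \<le> K powr ((2 - p) / 2) * ((\<Sum>z\<in>Z. g z powr p) / card Z)"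
proof -
  define M where "M = real (card Z)"
  have M: "0 < M" using Z by (simp add: M_def card_gt_0_iff)
  define E2 where "E2 = (\<Sum>z\<in>Z. (g z)\<^sup>2) / M"
  define Ep where "Ep = (\<Sum>z\<in>Z. g z powr p) / M"
  define E4 where "E4 = (\<Sum>z\<in>Z. g z ^ 4) / M"
  have nn: "0 \<le> E2" "0 \<le> Ep" "0 \<le> E4" using M g by (auto simp: E2_def Ep_def E4_def sum_nonneg)
  \<comment> \<open>The solution of \<open>p * a + 4 * (1 - a) = 2\<close>, which places the second
    moment between the other two.\<close>
  define a where "a = 2 / (4 - p)"
  have a: "0 < a" "a < 1" using p by (auto simp: a_def field_simps)
  define h where "h j z = (if j then g z powr p / M else g z ^ 4 / M)" for j z
  define t where "t j = (if j then a else 1 - a)" for j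
  have "E2 = (\<Sum>z\<in>Z. \<Prod>j\<in>UNIV. h j z powr t j)"
    unfolding E2_def sum_divide_distrib
  proof (rule sum.cong[OF refl])
    fix z assume "z \<in> Z"
    show "(g z)\<^sup>2 / M = (\<Prod>j\<in>UNIV. h j z powr t j)"
    proof (cases "g z = 0")
      case True
      then show ?thesis by (simp add: UNIV_bool h_def t_def)
    next
      case False
      then have gz: "0 < g z" using g[OF \<open>z \<in> Z\<close>] by simp
      have "a * (4 - p) = 2" using p by (simp add: a_def divide_simps)
      then have e: "p * a + 4 * (1 - a) = 2" by (simp add: algebra_simps)
      have "(\<Prod>j\<in>UNIV. h j z powr t j) = (g z powr p / M) powr a * (g z powr 4 / M) powr (1 - a)"
        using gz by (simp add: UNIV_bool h_def t_def mult.commute)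
      also have "\<dots> = g z powr (p * a + 4 * (1 - a)) / M powr (a + (1 - a))"
        using gz M by (simp add: powr_divide powr_powr flip: powr_add del: powr_numeral)
      also have "\<dots> = (g z)\<^sup>2 / M" unfolding e using gz M by simp
      finally show ?thesis ..
    qed
  qed
  also have "\<dots> \<le> (\<Prod>j\<in>UNIV. (\<Sum>z\<in>Z. h j z) powr t j)"
    using Z a M g by (intro generalized_holder) (auto simp: h_def t_def UNIV_bool)
  also have "\<dots> = Ep powr a * E4 powr (1 - a)"
    by (simp add: UNIV_bool h_def t_def Ep_def E4_def sum_divide_distrib mult.commute)
  also have "\<dots> \<le> Ep powr a * (K * E2\<^sup>2) powr (1 - a)"
    using K a nn by (intro mult_left_mono powr_mono2) (auto simp: E2_def E4_def M_def)
  finally have main: "E2 \<le> Ep powr a * (K * E2\<^sup>2) powr (1 - a)" .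
  have "E2 powr (p / 2) \<le> K powr ((2 - p) / 2) * Ep"
  proof (cases "E2 = 0")
    case True
    then show ?thesis using nn by simp
  next
    case False
    then have E2: "0 < E2" using nn by simp
    have "E2 \<le> Ep powr a * K powr (1 - a) * E2 powr (2 * (1 - a))"
      using main E2 K by (simp add: powr_mult powr_powr flip: powr_numeral)
    then have "E2 * E2 powr (- (2 * (1 - a))) \<le> Ep powr a * K powr (1 - a) * E2 powr (2 * (1 - a)) * E2 powr (- (2 * (1 - a)))"
      by (intro mult_right_mono) auto
    also have "\<dots> = Ep powr a * K powr (1 - a)"
      using E2 by (simp add: mult.assoc flip: powr_add)
    also have "E2 * E2 powr (- (2 * (1 - a))) = E2 powr (1 + - (2 * (1 - a)))"
      using E2 by (subst powr_add) simp
    \<comment> \<open>The exponent \<open>(4 - p) / 2\<close> is \<open>1 / a\<close>; it normalises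
      the power of \<open>Ep\<close> to one and that of \<open>E2\<close> to
      \<open>p / 2\<close>.\<close>
    finally have "(E2 powr (1 + - (2 * (1 - a)))) powr ((4 - p) / 2) \<le> (Ep powr a * K powr (1 - a)) powr ((4 - p) / 2)"
      using p by (intro powr_mono2) auto
    then have "E2 powr ((1 + - (2 * (1 - a))) * ((4 - p) / 2)) \<le> Ep powr (a * ((4 - p) / 2)) * K powr ((1 - a) * ((4 - p) / 2))"
      by (simp add: powr_mult powr_powr)
    moreover have "(1 + - (2 * (1 - a))) * ((4 - p) / 2) = p / 2" "a * ((4 - p) / 2) = 1"
      "(1 - a) * ((4 - p) / 2) = (2 - p) / 2"
      using p by (auto simp: a_def field_simps)
    ultimately show ?thesis using nn by (simp add: mult.commute)
  qed
  then show ?thesis by (simp add: E2_def Ep_def M_def)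
qed

text \<open>The case \<open>q = 2\<close> of \<open>lattice_sum\<close>, for arbitrary index sets,
  since the families below are indexed by torus points and by multi-indices.\<close>

definition square_function :: "'j set \<Rightarrow> ('j \<Rightarrow> 'a \<Rightarrow> complex) \<Rightarrow> 'a \<Rightarrow> complex"
  where "square_function J x = (\<lambda>\<omega>. complex_of_real (sqrt (\<Sum>j\<in>J. (cmod (x j \<omega>))\<^sup>2)))"

lemma lattice_sum_2: "lattice_sum 2 N x = square_function {..<N} x"
  by (simp add: lattice_sum_def square_function_def powr_half_sqrt sum_nonneg)

section \<open>Order and norm properties of Banach function spaces\<close>

context banach_function_space
begin

lemma zero_mem: "(\<lambda>\<omega>. 0) \<in> X"
  by (rule simple_mem) simp

lemma sum_mem: "(\<And>j. j \<in> J \<Longrightarrow> x j \<in> X) \<Longrightarrow> (\<lambda>\<omega>. \<Sum>j\<in>J. x j \<omega>) \<in> X"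
  by (induction J rule: infinite_finite_induct) (auto intro: zero_mem add_closed)

lemma nrm_nonneg: "f \<in> X \<Longrightarrow> 0 \<le> nrm f"
  using norm_mono[OF zero_mem, of f] norm_scale[of f 0] by simp

lemma nrm_cong: "f \<in> X \<Longrightarrow> g \<in> X \<Longrightarrow> (AE \<omega> in M. f \<omega> = g \<omega>) \<Longrightarrow> nrm f = nrm g"
  by (intro antisym norm_mono) auto

text \<open>The square function is dominated by the sum of the moduli, which belongs to
  \<open>X\<close>; the ideal property gives the rest.\<close>

lemma square_function_mem:
  assumes "\<And>j. j \<in> J \<Longrightarrow> x j \<in> X"
  shows "square_function J x \<in> X"
proof (rule ideal)
  have m: "x j \<in> borel_measurable M" if "j \<in> J" for j using assms that measurable by blast
  show "square_function J x \<in> borel_measurable M"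
    unfolding square_function_def using m by measurable
  have abs: "(\<lambda>\<omega>. complex_of_real (cmod (x j \<omega>))) \<in> X" if "j \<in> J" for j
    by (rule ideal[OF _ assms[OF that]]) (use m[OF that] in auto)
  show "(\<lambda>\<omega>. \<Sum>j\<in>J. complex_of_real (cmod (x j \<omega>))) \<in> X"
    by (rule sum_mem[OF abs])
  show "AE \<omega> in M. cmod (square_function J x \<omega>) \<le> cmod (\<Sum>j\<in>J. complex_of_real (cmod (x j \<omega>)))"
  proof (rule AE_I2)
    fix \<omega>
    have "sqrt (\<Sum>j\<in>J. (cmod (x j \<omega>))\<^sup>2) \<le> (\<Sum>j\<in>J. cmod (x j \<omega>))"
      by (rule L2_set_le_sum[unfolded L2_set_def]) simp
    then show "cmod (square_function J x \<omega>) \<le> cmod (\<Sum>j\<in>J. complex_of_real (cmod (x j \<omega>)))"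
      by (simp add: square_function_def sum_nonneg flip: of_real_sum)
  qed
qed

end

text \<open>2-concavity and 2-convexity in squared form with a common constant. The normalisation
  \<open>1 \<le> D\<close> allows powers of \<open>D\<close> to be enlarged to
  \<open>D ^ 4\<close>.\<close>

locale hilbertian_function_space = banach_function_space M X nrm
  for M :: "'a measure" and X nrm +
  fixes D :: real
  assumes D: "1 \<le> D"
    and concave_nat: "\<And>N x. (\<And>i. i < (N::nat) \<Longrightarrow> x i \<in> X) \<Longrightarrow>
      (\<Sum>i<N. (nrm (x i))\<^sup>2) \<le> D * (nrm (square_function {..<N} x))\<^sup>2"
    and convex_nat: "\<And>N x. (\<And>i. i < (N::nat) \<Longrightarrow> x i \<in> X) \<Longrightarrow>
      (nrm (square_function {..<N} x))\<^sup>2 \<le> D * (\<Sum>i<N. (nrm (x i))\<^sup>2)"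
begin

lemma
  assumes J: "finite J" and x: "\<And>j. j \<in> J \<Longrightarrow> x j \<in> X"
  shows concave: "(\<Sum>j\<in>J. (nrm (x j))\<^sup>2) \<le> D * (nrm (square_function J x))\<^sup>2"
    and convex: "(nrm (square_function J x))\<^sup>2 \<le> D * (\<Sum>j\<in>J. (nrm (x j))\<^sup>2)"
proof -
  obtain h where h: "bij_betw h {..<card J} J"
    using ex_bij_betw_nat_finite[OF J] by (auto simp: atLeast0LessThan)
  have s: "(\<Sum>i<card J. F (h i)) = sum F J" for F :: "_ \<Rightarrow> real"
    by (rule sum.reindex_bij_betw[OF h])
  have "square_function {..<card J} (\<lambda>i. x (h i)) = square_function J x"
    by (simp add: square_function_def s[of "\<lambda>j. (cmod (x j \<omega>))\<^sup>2" for \<omega>])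
  moreover have "x (h i) \<in> X" if "i < card J" for i
    using h that x by (auto simp: bij_betw_def)
  ultimately show "(\<Sum>j\<in>J. (nrm (x j))\<^sup>2) \<le> D * (nrm (square_function J x))\<^sup>2"
    "(nrm (square_function J x))\<^sup>2 \<le> D * (\<Sum>j\<in>J. (nrm (x j))\<^sup>2)"
    using concave_nat[of "card J" "\<lambda>i. x (h i)"] convex_nat[of "card J" "\<lambda>i. x (h i)"]
      s[of "\<lambda>j. (nrm (x j))\<^sup>2"] by simp_all
qed

lemma square_function_le:
  assumes "\<And>j. j \<in> J \<Longrightarrow> x j \<in> X" "\<And>j. j \<in> J' \<Longrightarrow> y j \<in> X" "0 \<le> C"
    and "\<And>\<omega>. (\<Sum>j\<in>J. (cmod (x j \<omega>))\<^sup>2) \<le> C * (\<Sum>j\<in>J'. (cmod (y j \<omega>))\<^sup>2)"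
  shows "(nrm (square_function J x))\<^sup>2 \<le> C * (nrm (square_function J' y))\<^sup>2"
proof -
  note mem = square_function_mem[of J x, OF assms(1)] square_function_mem[of J' y, OF assms(2)]
  have "nrm (square_function J x) \<le> nrm (\<lambda>\<omega>. complex_of_real (sqrt C) * square_function J' y \<omega>)"
  proof (rule norm_mono)
    show "AE \<omega> in M. cmod (square_function J x \<omega>) \<le> cmod (complex_of_real (sqrt C) * square_function J' y \<omega>)"
      using assms(3,4) by (intro AE_I2) (simp add: square_function_def norm_mult sum_nonneg flip: real_sqrt_mult)
  qed (use mem in \<open>auto intro: scale_closed\<close>)
  also have "\<dots> = sqrt C * nrm (square_function J' y)"
    using norm_scale[OF mem(2)] assms(3) by simp
  finally have "(nrm (square_function J x))\<^sup>2 \<le> (sqrt C * nrm (square_function J' y))\<^sup>2"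
    using nrm_nonneg mem by (intro power_mono) auto
  then show ?thesis using assms(3) by (simp add: power_mult_distrib)
qed

text \<open>The scalar Parseval and fourth moment estimates hold at every \<open>\<omega>\<close>;
  convexity and concavity transfer them to the norms \<open>g z\<close>. The result is a comparison
  of the fourth and second moments of \<open>g\<close>, so \<open>moment_interpolation\<close>
  applies with constant \<open>D ^ 4 * 4 ^ d\<close>.\<close>

lemma vector_hypercontractive:
  assumes \<Gamma>: "\<Gamma> \<subseteq> multi_indices n d" and N: "2 * d < N" and p: "0 < p" "p < 2"
    and x: "\<And>\<gamma>. \<gamma> \<in> \<Gamma> \<Longrightarrow> x \<gamma> \<in> X"
  shows "(\<Sum>\<gamma>\<in>\<Gamma>. (nrm (x \<gamma>))\<^sup>2) powr (p / 2)
    \<le> D ^ 4 * 2 powr ((2 - p) * d)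
      * ((\<Sum>z\<in>torus N n. nrm (\<lambda>\<omega>. \<Sum>\<gamma>\<in>\<Gamma>. monomial n \<gamma> z * x \<gamma> \<omega>) powr p) / card (torus N n))"
proof -
  have fin: "finite \<Gamma>" using \<Gamma> finite_subset finite_multi_indices by blast
  let ?Z = "torus N n"
  define L where "L = real N ^ n"
  have N0: "0 < N" using N by simp
  have four_d: "(4::real) ^ d = (2 ^ d)\<^sup>2" by (simp add: power2_eq_square flip: power_mult_distrib)
  have L: "0 < L" "real (card ?Z) = L" using N0 by (auto simp: L_def card_torus)
  have Z: "finite ?Z" "?Z \<noteq> {}" using N0 L by (auto simp flip: card_gt_0_iff)
  define f where "f z = (\<lambda>\<omega>. \<Sum>\<gamma>\<in>\<Gamma>. monomial n \<gamma> z * x \<gamma> \<omega>)" for z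
  have f: "f z \<in> X" for z unfolding f_def by (intro sum_mem scale_closed x)
  define g where "g z = nrm (f z)" for z
  have g: "0 \<le> g z" for z by (simp add: g_def nrm_nonneg f)
  have pars: "(\<Sum>z\<in>?Z. (cmod (f z \<omega>))\<^sup>2) = L * (\<Sum>\<gamma>\<in>\<Gamma>. (cmod (x \<gamma> \<omega>))\<^sup>2)" for \<omega>
    using torus_parseval[OF \<Gamma>, of N "\<lambda>\<gamma>. x \<gamma> \<omega>"] N by (simp add: f_def L_def mult.commute)
  have four: "(\<Sum>z\<in>?Z. cmod (f z \<omega>) ^ 4) \<le> L * 4 ^ d * (\<Sum>\<gamma>\<in>\<Gamma>. (cmod (x \<gamma> \<omega>))\<^sup>2)\<^sup>2" for \<omega>
    using torus_fourth_moment[OF \<Gamma> N, of "\<lambda>\<gamma>. x \<gamma> \<omega>"] by (simp add: f_def L_def mult.commute)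
  define E2 where "E2 = (\<Sum>z\<in>?Z. (g z)\<^sup>2) / L"
  define E4 where "E4 = (\<Sum>z\<in>?Z. g z ^ 4) / L"
  have nn: "0 \<le> E2" "0 \<le> E4" using L by (auto simp: E2_def E4_def sum_nonneg)
  have S4: "(\<Sum>z\<in>?Z. g z ^ 4) = L * E4" and S2: "(\<Sum>z\<in>?Z. (g z)\<^sup>2) = L * E2"
    using L by (auto simp: E4_def E2_def)
  text \<open>
    No 4-convexity is available, so \<open>g\<^sup>4\<close> is read as the square of \<open>\<parallel>g f\<parallel>\<close>; then
    2-concavity, the scalar fourth moment estimate and 2-convexity bound it.
  \<close>
  have "(\<Sum>z\<in>?Z. g z ^ 4) = (\<Sum>z\<in>?Z. (nrm (\<lambda>\<omega>. complex_of_real (g z) * f z \<omega>))\<^sup>2)"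
    using f g by (intro sum.cong refl) (simp add: norm_scale power_mult_distrib g_def[symmetric] flip: power_add)
  also have "\<dots> \<le> D * (nrm (square_function ?Z (\<lambda>z \<omega>. complex_of_real (g z) * f z \<omega>)))\<^sup>2"
    by (intro concave Z scale_closed f)
  also have "\<dots> \<le> D * ((sqrt E4 * 2 ^ d) * (nrm (square_function ?Z f))\<^sup>2)"
  proof (intro mult_left_mono square_function_le scale_closed f)
    fix \<omega>
    let ?s = "\<Sum>\<gamma>\<in>\<Gamma>. (cmod (x \<gamma> \<omega>))\<^sup>2"
    have s: "0 \<le> ?s" by (simp add: sum_nonneg)
    have "((\<Sum>z\<in>?Z. (g z)\<^sup>2 * (cmod (f z \<omega>))\<^sup>2))\<^sup>2
      \<le> (\<Sum>z\<in>?Z. ((g z)\<^sup>2)\<^sup>2) * (\<Sum>z\<in>?Z. ((cmod (f z \<omega>))\<^sup>2)\<^sup>2)"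
      by (rule Cauchy_Schwarz_ineq_sum)
    also have "\<dots> = (L * E4) * (\<Sum>z\<in>?Z. cmod (f z \<omega>) ^ 4)"
      using S4 by simp
    also have "\<dots> \<le> (L * E4) * (L * 4 ^ d * ?s\<^sup>2)"
      using L nn by (intro mult_left_mono four) auto
    also have "\<dots> = (sqrt E4 * 2 ^ d * (L * ?s))\<^sup>2"
      using nn by (simp add: power_mult_distrib four_d) (simp add: power2_eq_square mult_ac)
    finally have "(\<Sum>z\<in>?Z. (g z)\<^sup>2 * (cmod (f z \<omega>))\<^sup>2) \<le> sqrt E4 * 2 ^ d * (L * ?s)"
    proof (rule power2_le_imp_le)
      show "0 \<le> sqrt E4 * 2 ^ d * (L * ?s)"
        using L nn s by (intro mult_nonneg_nonneg) auto
    qed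
    then show "(\<Sum>z\<in>?Z. (cmod (complex_of_real (g z) * f z \<omega>))\<^sup>2)
      \<le> sqrt E4 * 2 ^ d * (\<Sum>z\<in>?Z. (cmod (f z \<omega>))\<^sup>2)"
      using g by (simp add: norm_mult power_mult_distrib pars)
  qed (use D nn in auto)
  also have "\<dots> \<le> D * ((sqrt E4 * 2 ^ d) * (D * (\<Sum>z\<in>?Z. (nrm (f z))\<^sup>2)))"
    using D nn by (intro mult_left_mono convex Z f) auto
  \<comment> \<open>The fourth moment bounds itself, but on the right it occurs only under a square
    root, which can be cancelled.\<close>
  finally have "L * E4 \<le> L * (D\<^sup>2 * 2 ^ d * E2 * sqrt E4)"
    using S4 S2 by (simp add: g_def power2_eq_square mult_ac)
  then have E42: "sqrt E4 * sqrt E4 \<le> (D\<^sup>2 * 2 ^ d * E2) * sqrt E4"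
    using L nn by simp
  have E4_le: "E4 \<le> D ^ 4 * 4 ^ d * E2\<^sup>2"
  proof (cases "E4 = 0")
    case True
    then show ?thesis using D by simp
  next
    case False
    then have "0 < sqrt E4" using nn by simp
    then have "sqrt E4 \<le> D\<^sup>2 * 2 ^ d * E2" by (rule mult_right_le_imp_le[OF E42])
    then have "(sqrt E4)\<^sup>2 \<le> (D\<^sup>2 * 2 ^ d * E2)\<^sup>2" using nn by (intro power_mono) auto
    then show ?thesis
      using nn by (simp add: power_mult_distrib four_d flip: power_mult)
  qed
  \<comment> \<open>Concavity, pointwise Parseval and convexity compare the coefficients with the
    second moment of \<open>g\<close>.\<close>
  have "(\<Sum>\<gamma>\<in>\<Gamma>. (nrm (x \<gamma>))\<^sup>2) \<le> D * (nrm (square_function \<Gamma> x))\<^sup>2"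
    by (intro concave fin x)
  also have "\<dots> \<le> D * ((1 / L) * (nrm (square_function ?Z f))\<^sup>2)"
    using D L by (intro mult_left_mono square_function_le x f) (auto simp: pars)
  also have "\<dots> \<le> D * ((1 / L) * (D * (\<Sum>z\<in>?Z. (nrm (f z))\<^sup>2)))"
    using D L by (intro mult_left_mono convex Z f) auto
  also have "\<dots> = D\<^sup>2 * E2" by (simp add: E2_def g_def power2_eq_square)
  finally have "(\<Sum>\<gamma>\<in>\<Gamma>. (nrm (x \<gamma>))\<^sup>2) powr (p / 2) \<le> (D\<^sup>2 * E2) powr (p / 2)"
    using p by (intro powr_mono2) (auto intro!: sum_nonneg)
  also have "\<dots> = D powr p * E2 powr (p / 2)"
    using D nn by (simp add: powr_mult powr_powr flip: powr_numeral)
  also have "\<dots> \<le> D powr p * ((D ^ 4 * 4 ^ d) powr ((2 - p) / 2) * ((\<Sum>z\<in>?Z. g z powr p) / L))"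
    using moment_interpolation[OF Z p g, of "D ^ 4 * 4 ^ d"] E4_le D
    by (intro mult_left_mono) (auto simp: E2_def E4_def L)
  also have "(D ^ 4 * 4 ^ d) powr ((2 - p) / 2) = D powr (2 * (2 - p)) * 2 powr ((2 - p) * d)"
  proof -
    have "(4::real) ^ d = 2 powr (2 * d)"
      by (simp add: powr_realpow[symmetric] powr_powr[symmetric])
    moreover have "D ^ 4 = D powr 4" using D by simp
    ultimately have "(D ^ 4 * 4 ^ d) powr ((2 - p) / 2) = (D powr 4) powr ((2 - p) / 2) * (2 powr (2 * d)) powr ((2 - p) / 2)"
      using D by (simp only: powr_mult)
    also have "\<dots> = D powr (4 * ((2 - p) / 2)) * 2 powr ((2 * d) * ((2 - p) / 2))"
      by (simp only: powr_powr)
    also have "4 * ((2 - p) / 2) = 2 * (2 - p)" by simp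
    also have "(2 * d) * ((2 - p) / 2) = (2 - p) * d" by simp
    finally show ?thesis .
  qed
  also have "D powr p * (D powr (2 * (2 - p)) * 2 powr ((2 - p) * d) * ((\<Sum>z\<in>?Z. g z powr p) / L))
    = D powr (p + 2 * (2 - p)) * (2 powr ((2 - p) * d) * ((\<Sum>z\<in>?Z. g z powr p) / L))"
    unfolding powr_add by (simp only: mult.assoc)
  \<comment> \<open>The accumulated exponent of \<open>D\<close> is \<open>4 - p\<close>; it is
    rounded up to \<open>4\<close>.\<close>
  also have "\<dots> \<le> D powr 4 * (2 powr ((2 - p) * d) * ((\<Sum>z\<in>?Z. g z powr p) / L))"
    using D L p by (intro mult_right_mono powr_mono) (auto intro!: sum_nonneg mult_nonneg_nonneg divide_nonneg_pos)
  also have "D powr 4 = D ^ 4" using D by simp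
  finally show ?thesis by (simp add: g_def f_def L mult.assoc)
qed

end

section \<open>Multi-indices as monotone maps\<close>

text \<open>The exponent vector of the product of the variables \<open>z (i j)\<close> over
  \<open>j\<close> in \<open>V\<close>.\<close>

definition count_index :: "nat \<Rightarrow> nat set \<Rightarrow> (nat \<Rightarrow> nat) \<Rightarrow> nat \<Rightarrow> nat"
  where "count_index n V i = (\<lambda>x\<in>{..<n}. card {j \<in> V. i j = x})"

lemma count_index_mem:
  assumes "finite V" "i ` V \<subseteq> {..<n}"
  shows "count_index n V i \<in> multi_indices n (card V)"
proof -
  have "(\<Sum>x<n. card {j \<in> V. i j = x}) = card V"
    using sum.group[of V "{..<n}" i "\<lambda>_. 1::nat"] assms by simp
  then show ?thesis by (simp add: multi_indices_def count_index_def)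
qed

lemma count_index_Un:
  assumes "finite V" "S \<subseteq> V"
  shows "count_index n V i = index_add n (count_index n S i) (count_index n (V - S) i)"
proof -
  have "card {j \<in> V. i j = x} = card {j \<in> S. i j = x} + card {j \<in> V - S. i j = x}" for x
  proof -
    have "{j \<in> V. i j = x} = {j \<in> S. i j = x} \<union> {j \<in> V - S. i j = x}" using assms by auto
    then show ?thesis
      using assms by (subst card_Un_disjoint[symmetric]) (auto intro: finite_subset)
  qed
  then show ?thesis by (auto simp: count_index_def index_add_def)
qed

lemma count_index_cong: "(\<And>j. j \<in> S \<Longrightarrow> i j = i' j) \<Longrightarrow> count_index n S i = count_index n S i'"
  unfolding count_index_def by (intro restrict_ext arg_cong[of _ _ card]) auto

text \<open>If \<open>i j < i' j\<close>, then \<open>i\<close> is at most \<open>i j\<close> on all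
  elements of \<open>S\<close> up to \<open>j\<close>, whereas \<open>i'\<close> is so only on
  elements strictly before \<open>j\<close>. This contradicts the comparison of cardinalities at
  \<open>x = i j\<close>.\<close>

lemma mono_on_le_of_card_le:
  fixes S :: "nat set"
  assumes S: "finite S" and mono: "mono_on S i" "mono_on S i'" and j: "j \<in> S"
    and le: "\<And>x. card {l \<in> S. i l \<le> x} \<le> card {l \<in> S. i' l \<le> x}"
  shows "i' j \<le> (i j :: nat)"
proof (rule ccontr)
  assume "\<not> i' j \<le> i j"
  then have lt: "i j < i' j" by simp
  have "card {l \<in> S. l \<le> j} \<le> card {l \<in> S. i l \<le> i j}"
    using S j mono by (intro card_mono) (auto dest: mono_onD)
  also have "\<dots> \<le> card {l \<in> S. i' l \<le> i j}" by (rule le)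
  also have "\<dots> \<le> card {l \<in> S. l < j}"
  proof (intro card_mono subsetI)
    fix l assume "l \<in> {l \<in> S. i' l \<le> i j}"
    then have "l \<in> S" "i' l < i' j" using lt by auto
    then have "l < j" using mono_onD[OF mono(2) j, of l] by (meson not_le_imp_less not_less)
    then show "l \<in> {l \<in> S. l < j}" using \<open>l \<in> S\<close> by simp
  qed (use S in simp)
  also have "\<dots> < card {l \<in> S. l \<le> j}"
    using S j by (intro psubset_card_mono) auto
  finally show False by simp
qed

text \<open>Partial sums of the counts give the number of arguments with value at most
  \<open>x\<close>, and these numbers determine a monotone map by comparison in both
  directions.\<close>

lemma mono_on_count_index_inj:
  assumes S: "finite S" and mono: "mono_on S i" "mono_on S i'" and ran: "i ` S \<subseteq> {..<n}" "i' ` S \<subseteq> {..<n}"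
    and eq: "count_index n S i = count_index n S i'" and j: "j \<in> S"
  shows "i j = i' j"
proof -
  have c: "card {l \<in> S. h l \<le> x} = (\<Sum>y\<in>{..<n} \<inter> {..x}. count_index n S h y)"
    if "h ` S \<subseteq> {..<n}" for h x
  proof -
    have "(\<Sum>y\<in>{..<n} \<inter> {..x}. count_index n S h y)
      = (\<Sum>y\<in>{..<n} \<inter> {..x}. card {l \<in> {l \<in> S. h l \<le> x}. h l = y})"
      by (intro sum.cong refl) (auto simp: count_index_def intro!: arg_cong[of _ _ card])
    also have "\<dots> = card {l \<in> S. h l \<le> x}"
      using sum.group[of "{l \<in> S. h l \<le> x}" "{..<n} \<inter> {..x}" h "\<lambda>_. 1::nat"] S that by auto
    finally show ?thesis ..
  qed
  have "card {l \<in> S. i l \<le> x} = card {l \<in> S. i' l \<le> x}" for x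
    using c[OF ran(1)] c[OF ran(2)] eq by simp
  then show ?thesis
    using mono_on_le_of_card_le[OF S mono j] mono_on_le_of_card_le[OF S mono(2,1) j]
    by (intro antisym) auto
qed

text \<open>The map lists in increasing order the multiset containing each \<open>x < n\<close> with
  multiplicity \<open>\<alpha> x\<close>.\<close>

lemma ex_mono_count_index:
  assumes \<alpha>: "\<alpha> \<in> multi_indices n m"
  shows "\<exists>i\<in>{..<m} \<rightarrow>\<^sub>E {..<n}. mono_on {..<m} i \<and> count_index n {..<m} i = \<alpha>"
proof -
  define A where "A = (\<Sum>x<n. replicate_mset (\<alpha> x) x)"
  define xs where "xs = sorted_list_of_multiset A"
  have cnt: "count A x = (if x < n then \<alpha> x else 0)" for x
    by (simp add: A_def count_sum)
  have card: "card {j. j < length xs \<and> xs ! j = x} = (if x < n then \<alpha> x else 0)" for x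
  proof -
    have "card {j. j < length xs \<and> xs ! j = x} = length (filter (\<lambda>y. y = x) xs)"
      by (rule length_filter_conv_card[symmetric])
    also have "\<dots> = count (mset xs) x" by (induction xs) auto
    finally show ?thesis by (simp add: xs_def cnt)
  qed
  have ran: "xs ! j < n" if "j < length xs" for j
  proof -
    have "xs ! j \<in># A" using that nth_mem[of j xs] by (simp add: xs_def)
    then show ?thesis using cnt[of "xs ! j"] by (auto simp flip: count_greater_zero_iff split: if_splits)
  qed
  have "(!) xs ` {..<length xs} \<subseteq> {..<n}" using ran by auto
  then have "length xs = (\<Sum>x<n. card {j \<in> {..<length xs}. xs ! j = x})"
    using sum.group[of "{..<length xs}" "{..<n}" "(!) xs" "\<lambda>_. 1::nat"] by simp
  also have "\<dots> = (\<Sum>x<n. \<alpha> x)" using card by simp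
  also have "\<dots> = m" using \<alpha> by (simp add: multi_indices_def)
  finally have len: "length xs = m" .
  define i where "i = restrict ((!) xs) {..<m}"
  have "i \<in> {..<m} \<rightarrow>\<^sub>E {..<n}" using ran len by (auto simp: i_def)
  moreover have "mono_on {..<m} i"
    using sorted_sorted_list_of_multiset[of A] len
    by (auto simp: i_def xs_def mono_on_def intro: sorted_nth_mono)
  moreover have "count_index n {..<m} i = \<alpha>"
  proof (rule multi_indices_eqI[OF _ \<alpha>])
    show "count_index n {..<m} i \<in> multi_indices n (card {..<m})"
      using ran len by (intro count_index_mem) (auto simp: i_def)
    fix x assume "x < n"
    have "{j \<in> {..<m}. i j = x} = {j. j < length xs \<and> xs ! j = x}" by (auto simp: i_def len)
    then show "count_index n {..<m} i x = \<alpha> x" using card[of x] \<open>x < n\<close> by (simp add: count_index_def)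
  qed
  ultimately show ?thesis by blast
qed

text \<open>
  A multi-index is represented by its unique monotone enumeration. Restrictions of monotone
  maps are monotone and hence again determined by their counts, so no multinomial
  coefficients enter.
\<close>

lemma sum_multi_indices_le_blei_sum:
  fixes F :: "(nat \<Rightarrow> nat) \<Rightarrow> real"
  assumes a: "\<And>i. a i = (if mono_on {..<m} i then F (count_index n {..<m} i) else 0)"
  shows "(\<Sum>\<alpha>\<in>multi_indices n m. F \<alpha> powr \<rho>) \<le> (\<Sum>i\<in>{..<m} \<rightarrow>\<^sub>E {..<n}. a i powr \<rho>)"
proof -
  obtain h where h: "\<And>\<alpha>. \<alpha> \<in> multi_indices n m \<Longrightarrow>
      h \<alpha> \<in> {..<m} \<rightarrow>\<^sub>E {..<n} \<and> mono_on {..<m} (h \<alpha>) \<and> count_index n {..<m} (h \<alpha>) = \<alpha>"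
    using ex_mono_count_index[of _ n m] by metis
  have inj: "inj_on h (multi_indices n m)"
    by (rule inj_on_inverseI[where g = "count_index n {..<m}"]) (use h in blast)
  have "(\<Sum>\<alpha>\<in>multi_indices n m. F \<alpha> powr \<rho>) = (\<Sum>\<alpha>\<in>multi_indices n m. a (h \<alpha>) powr \<rho>)"
    using h by (intro sum.cong refl) (simp add: a)
  also have "\<dots> = (\<Sum>i\<in>h ` multi_indices n m. a i powr \<rho>)"
    by (simp add: sum.reindex[OF inj])
  also have "\<dots> \<le> (\<Sum>i\<in>{..<m} \<rightarrow>\<^sub>E {..<n}. a i powr \<rho>)"
    using h by (intro sum_mono2) (auto simp: finite_PiE)
  finally show ?thesis .
qed

text \<open>This turns the hypothesis of \<open>blei\<close> into a sum over multi-indices. A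
  monotone \<open>i\<close> splits into its restrictions to \<open>S\<close> and to the complement,
  with counts \<open>\<beta>\<close> and \<open>\<gamma>\<close>; both assignments are injective,
  and adding the missing indices only adds nonnegative terms.\<close>

lemma mixed_sum_le_multi_indices:
  fixes F :: "(nat \<Rightarrow> nat) \<Rightarrow> real"
  assumes p: "0 < p"
    and a: "\<And>i. a i = (if mono_on {..<m} i then F (count_index n {..<m} i) else 0)"
    and S: "S \<subseteq> {..<m}" "card S = k"
  shows "(\<Sum>u\<in>S \<rightarrow>\<^sub>E {..<n}. (\<Sum>i\<in>{i \<in> {..<m} \<rightarrow>\<^sub>E {..<n}. restrict i S = u}. (a i)\<^sup>2) powr (p / 2))
    \<le> (\<Sum>\<beta>\<in>multi_indices n k. (\<Sum>\<gamma>\<in>multi_indices n (m - k). (F (index_add n \<beta> \<gamma>))\<^sup>2) powr (p / 2))"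
proof -
  let ?V = "{..<m}" and ?I = "{..<n}"
  have finS: "finite S" using S(1) by (rule finite_subset) simp
  have cardT: "card (?V - S) = m - k" using S by (simp add: card_Diff_subset finS)
  define U where "U = {u \<in> S \<rightarrow>\<^sub>E ?I. mono_on S u}"
  define s where "s u = (\<Sum>i\<in>{i \<in> ?V \<rightarrow>\<^sub>E ?I. restrict i S = u}. (a i)\<^sup>2)" for u
  define G where "G \<beta> = (\<Sum>\<gamma>\<in>multi_indices n (m - k). (F (index_add n \<beta> \<gamma>))\<^sup>2)" for \<beta>
  have s0: "s u = 0" if "u \<in> (S \<rightarrow>\<^sub>E ?I) - U" for u
    unfolding s_def
  proof (intro sum.neutral ballI)
    fix i assume i: "i \<in> {i \<in> ?V \<rightarrow>\<^sub>E ?I. restrict i S = u}"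
    have "\<not> mono_on ?V i"
    proof
      assume "mono_on ?V i"
      then have "mono_on S i" using S(1) by (rule mono_on_subset)
      then have "mono_on S u" using i by (auto simp: mono_on_def restrict_def)
      then show False using that by (simp add: U_def)
    qed
    then show "(a i)\<^sup>2 = 0" by (simp add: a)
  qed
  have sG: "s u \<le> G (count_index n S u)" if u: "u \<in> U" for u
  proof -
    define W where "W = {i \<in> ?V \<rightarrow>\<^sub>E ?I. restrict i S = u \<and> mono_on ?V i}"
    have uS: "i j = u j" if "i \<in> W" "j \<in> S" for i j
    proof -
      have "u j = restrict i S j" using that(1) unfolding W_def by blast
      then show ?thesis using that(2) by simp
    qed
    have inj: "inj_on (count_index n (?V - S)) W"
    proof (rule inj_onI)
      fix i i' assume *: "i \<in> W" "i' \<in> W" "count_index n (?V - S) i = count_index n (?V - S) i'"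
      have "i j = i' j" if "j \<in> ?V" for j
      proof (cases "j \<in> S")
        case True
        then show ?thesis using uS[OF *(1)] uS[OF *(2)] by simp
      next
        case False
        have "mono_on (?V - S) i" "mono_on (?V - S) i'"
          using * by (auto simp: W_def mono_on_def)
        then show ?thesis
          using * that False by (intro mono_on_count_index_inj[of "?V - S" i i' n]) (auto simp: W_def PiE_iff)
      qed
      then show "i = i'"
        using * by (intro PiE_ext[of i ?V "\<lambda>_. ?I" i']) (simp_all add: W_def)
    qed
    have "s u = (\<Sum>i\<in>W. (a i)\<^sup>2)"
      unfolding s_def by (rule sum.mono_neutral_right) (auto simp: W_def a finite_PiE)
    also have "\<dots> = (\<Sum>i\<in>W. (F (index_add n (count_index n S u) (count_index n (?V - S) i)))\<^sup>2)"
    proof (intro sum.cong refl)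
      fix i assume i: "i \<in> W"
      have "count_index n ?V i = index_add n (count_index n S i) (count_index n (?V - S) i)"
        using S by (intro count_index_Un) auto
      also have "count_index n S i = count_index n S u"
        using uS[OF i] by (rule count_index_cong)
      finally show "(a i)\<^sup>2 = (F (index_add n (count_index n S u) (count_index n (?V - S) i)))\<^sup>2"
        using i by (simp add: a W_def)
    qed
    also have "\<dots> = (\<Sum>\<gamma>\<in>count_index n (?V - S) ` W. (F (index_add n (count_index n S u) \<gamma>))\<^sup>2)"
      by (simp add: sum.reindex[OF inj])
    also have "\<dots> \<le> G (count_index n S u)"
      unfolding G_def
    proof (rule sum_mono2)
      show "count_index n (?V - S) ` W \<subseteq> multi_indices n (m - k)"
        unfolding cardT[symmetric] by (auto simp: W_def intro!: count_index_mem)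
    qed auto
    finally show ?thesis .
  qed
  have injU: "inj_on (count_index n S) U"
  proof (rule inj_onI)
    fix u u' assume *: "u \<in> U" "u' \<in> U" "count_index n S u = count_index n S u'"
    then have "u j = u' j" if "j \<in> S" for j
      using that finS by (intro mono_on_count_index_inj[of S u u' n]) (auto simp: U_def)
    then show "u = u'"
      using * by (intro PiE_ext[of u S "\<lambda>_. ?I" u']) (simp_all add: U_def)
  qed
  have "(\<Sum>u\<in>S \<rightarrow>\<^sub>E ?I. s u powr (p / 2)) = (\<Sum>u\<in>U. s u powr (p / 2))"
    using s0 finS p by (intro sum.mono_neutral_right) (auto simp: U_def finite_PiE)
  also have "\<dots> \<le> (\<Sum>u\<in>U. G (count_index n S u) powr (p / 2))"
    using p sG by (intro sum_mono powr_mono2) (auto simp: s_def sum_nonneg)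
  also have "\<dots> = (\<Sum>\<beta>\<in>count_index n S ` U. G \<beta> powr (p / 2))"
    by (simp add: sum.reindex[OF injU])
  also have "\<dots> \<le> (\<Sum>\<beta>\<in>multi_indices n k. G \<beta> powr (p / 2))"
  proof (rule sum_mono2)
    show "count_index n S ` U \<subseteq> multi_indices n k"
      unfolding S(2)[symmetric] using finS by (auto simp: U_def intro!: count_index_mem)
  qed auto
  finally show ?thesis by (simp add: s_def G_def)
qed

section \<open>Taylor expansion of vector-valued polynomials\<close>

lemma scaleC_zero_right [simp]: "a *\<^sub>C (0 :: 'y::complex_normed_vector) = 0"
  using norm_scaleC[of a "0 :: 'y"] by simp

lemma scaleC_zero_left [simp]: "0 *\<^sub>C (x :: 'y::complex_normed_vector) = 0"
  using norm_scaleC[of 0 x] by simp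

lemma scaleC_sum_right: "a *\<^sub>C (\<Sum>j\<in>J. f j) = (\<Sum>j\<in>J. a *\<^sub>C (f j :: 'y::complex_normed_vector))"
  by (induction J rule: infinite_finite_induct) (auto simp: scaleC_add_right)

lemma scaleC_sum_left: "(\<Sum>j\<in>J. a j) *\<^sub>C x = (\<Sum>j\<in>J. a j *\<^sub>C (x :: 'y::complex_normed_vector))"
  by (induction J rule: infinite_finite_induct) (auto simp: scaleC_add_left)

definition index_choose :: "nat \<Rightarrow> (nat \<Rightarrow> nat) \<Rightarrow> (nat \<Rightarrow> nat) \<Rightarrow> nat"
  where "index_choose n \<alpha> \<beta> = (\<Prod>i<n. \<alpha> i choose \<beta> i)"

text \<open>The coefficient of \<open>w\<^sup>\<beta>\<close> in \<open>P(z + w)\<close>, where \<open>|\<beta>| + l\<close> is the degree of \<open>P\<close>.\<close>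

definition taylor_coeff ::
  "nat \<Rightarrow> nat \<Rightarrow> ((nat \<Rightarrow> nat) \<Rightarrow> 'y::complex_normed_vector) \<Rightarrow> (nat \<Rightarrow> complex) \<Rightarrow> (nat \<Rightarrow> nat) \<Rightarrow> 'y"
  where "taylor_coeff n l c z \<beta> = (\<Sum>\<gamma>\<in>multi_indices n l.
    monomial n \<gamma> z *\<^sub>C of_nat (index_choose n (index_add n \<beta> \<gamma>) \<beta>) *\<^sub>C c (index_add n \<beta> \<gamma>))"

lemma monomial_cong: "(\<And>i. i < n \<Longrightarrow> z i = w i) \<Longrightarrow> monomial n \<alpha> z = monomial n \<alpha> w"
  by (simp add: monomial_def)

lemma monomial_scale:
  "\<alpha> \<in> multi_indices n m \<Longrightarrow> monomial n \<alpha> (\<lambda>i. s * z i) = s ^ m * monomial n \<alpha> z"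
  by (simp add: monomial_def power_mult_distrib prod.distrib multi_indices_def flip: power_sum)

lemma norm_monomial_le_1: "(\<And>i. i < n \<Longrightarrow> cmod (z i) \<le> 1) \<Longrightarrow> cmod (monomial n \<alpha> z) \<le> 1"
  unfolding monomial_def prod_norm[symmetric] by (intro prod_le_1) (auto simp: norm_power power_le_one)

text \<open>After binomial expansion, the term of \<open>\<beta>\<close> carries the power of
  \<open>t * u\<close> given by the degree of \<open>\<beta>\<close>. Averaging against
  \<open>cnj (u ^ k)\<close> keeps degree \<open>k\<close> only, because all degrees are at most
  \<open>m < N\<close>.\<close>

lemma monomial_add_average:
  assumes \<alpha>: "\<alpha> \<in> multi_indices n m" and N: "m < N" "k < N"
  shows "(\<Sum>u\<in>{u. u ^ N = 1}. cnj (u ^ k) * monomial n \<alpha> (\<lambda>i. z i + t * u * w i))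
    = N * t ^ k * (\<Sum>\<beta>\<in>{\<beta> \<in> multi_indices n k. \<forall>i<n. \<beta> i \<le> \<alpha> i}.
        of_nat (index_choose n \<alpha> \<beta>) * monomial n \<beta> w * (\<Prod>i<n. z i ^ (\<alpha> i - \<beta> i)))"
proof -
  let ?B = "\<Pi>\<^sub>E i\<in>{..<n}. {..\<alpha> i}"
  define s where "s \<beta> = (\<Sum>i<n. \<beta> i)" for \<beta> :: "nat \<Rightarrow> nat"
  define T where "T \<beta> = of_nat (index_choose n \<alpha> \<beta>) * monomial n \<beta> w * (\<Prod>i<n. z i ^ (\<alpha> i - \<beta> i))" for \<beta>
  have sB: "s \<beta> \<le> m" if "\<beta> \<in> ?B" for \<beta>
    using \<alpha> that by (auto simp: s_def multi_indices_def PiE_iff intro!: sum_mono)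
  have "monomial n \<alpha> (\<lambda>i. z i + t * u * w i) = (\<Sum>\<beta>\<in>?B. t ^ s \<beta> * u ^ s \<beta> * T \<beta>)" for u
  proof -
    have "monomial n \<alpha> (\<lambda>i. z i + t * u * w i)
      = (\<Prod>i<n. \<Sum>b\<le>\<alpha> i. of_nat (\<alpha> i choose b) * (t * u * w i) ^ b * z i ^ (\<alpha> i - b))"
      by (simp add: monomial_def add.commute[of "z _"] binomial_ring)
    also have "\<dots> = (\<Sum>\<beta>\<in>?B. \<Prod>i<n. of_nat (\<alpha> i choose \<beta> i) * (t * u * w i) ^ \<beta> i * z i ^ (\<alpha> i - \<beta> i))"
      by (rule prod_sum_PiE) auto
    also have "\<dots> = (\<Sum>\<beta>\<in>?B. t ^ s \<beta> * u ^ s \<beta> * T \<beta>)"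
      by (simp add: T_def s_def index_choose_def monomial_def prod.distrib power_mult_distrib power_sum mult_ac)
    finally show ?thesis .
  qed
  then have "(\<Sum>u\<in>{u. u ^ N = 1}. cnj (u ^ k) * monomial n \<alpha> (\<lambda>i. z i + t * u * w i))
    = (\<Sum>u\<in>{u. u ^ N = 1}. \<Sum>\<beta>\<in>?B. t ^ s \<beta> * T \<beta> * (u ^ s \<beta> * cnj (u ^ k)))"
    by (simp add: sum_distrib_left mult_ac)
  also have "\<dots> = (\<Sum>\<beta>\<in>?B. t ^ s \<beta> * T \<beta> * (\<Sum>u\<in>{u. u ^ N = 1}. u ^ s \<beta> * cnj (u ^ k)))"
    by (subst sum.swap) (simp only: sum_distrib_left)
  also have "\<dots> = (\<Sum>\<beta>\<in>?B. if s \<beta> = k then N * t ^ k * T \<beta> else 0)"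
  proof (intro sum.cong refl)
    fix \<beta> assume "\<beta> \<in> ?B"
    then have "s \<beta> \<le> m" by (rule sB)
    then have "s \<beta> < N" using N(1) by (rule le_less_trans)
    then show "t ^ s \<beta> * T \<beta> * (\<Sum>u\<in>{u. u ^ N = 1}. u ^ s \<beta> * cnj (u ^ k))
      = (if s \<beta> = k then N * t ^ k * T \<beta> else 0)"
      unfolding sum_roots_of_unity_orthogonal[OF \<open>s \<beta> < N\<close> N(2)] by simp
  qed
  also have "\<dots> = (\<Sum>\<beta>\<in>{\<beta> \<in> ?B. s \<beta> = k}. N * t ^ k * T \<beta>)"
    by (rule sum.inter_filter[symmetric]) (simp add: finite_PiE)
  also have "{\<beta> \<in> ?B. s \<beta> = k} = {\<beta> \<in> multi_indices n k. \<forall>i<n. \<beta> i \<le> \<alpha> i}"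
    by (auto simp: multi_indices_def s_def PiE_iff)
  finally show ?thesis by (simp add: sum_distrib_left T_def)
qed

text \<open>The substitution is \<open>\<gamma> = \<alpha> - \<beta>\<close>, taken
  coordinatewise.\<close>

lemma sum_index_add_reindex:
  fixes F :: "(nat \<Rightarrow> nat) \<Rightarrow> (nat \<Rightarrow> nat) \<Rightarrow> 'y::comm_monoid_add"
  shows "(\<Sum>\<alpha>\<in>multi_indices n (k + l). \<Sum>\<beta>\<in>{\<beta> \<in> multi_indices n k. \<forall>i<n. \<beta> i \<le> \<alpha> i}. F \<alpha> \<beta>)
    = (\<Sum>\<beta>\<in>multi_indices n k. \<Sum>\<gamma>\<in>multi_indices n l. F (index_add n \<beta> \<gamma>) \<beta>)"
proof -
  have "(\<Sum>\<alpha>\<in>multi_indices n (k + l). \<Sum>\<beta>\<in>{\<beta> \<in> multi_indices n k. \<forall>i<n. \<beta> i \<le> \<alpha> i}. F \<alpha> \<beta>)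
    = (\<Sum>(\<alpha>, \<beta>)\<in>(SIGMA \<alpha>:multi_indices n (k + l). {\<beta> \<in> multi_indices n k. \<forall>i<n. \<beta> i \<le> \<alpha> i}). F \<alpha> \<beta>)"
    by (rule sum.Sigma) auto
  also have "\<dots> = (\<Sum>(\<beta>, \<gamma>)\<in>multi_indices n k \<times> multi_indices n l. F (index_add n \<beta> \<gamma>) \<beta>)"
  proof (rule sum.reindex_bij_witness[where i = "\<lambda>(\<beta>, \<gamma>). (index_add n \<beta> \<gamma>, \<beta>)"
        and j = "\<lambda>(\<alpha>, \<beta>). (\<beta>, \<lambda>i\<in>{..<n}. \<alpha> i - \<beta> i)"], goal_cases)
    case (1 x)
    then show ?case by (auto simp: index_add_def multi_indices_def PiE_iff extensional_def fun_eq_iff)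
  next
    case (2 x)
    then obtain \<alpha> \<beta> where x: "x = (\<alpha>, \<beta>)" "\<alpha> \<in> multi_indices n (k + l)"
      "\<beta> \<in> multi_indices n k" "\<And>i. i < n \<Longrightarrow> \<beta> i \<le> \<alpha> i" by auto
    have "(\<Sum>i<n. \<alpha> i - \<beta> i) = (\<Sum>i<n. \<alpha> i) - (\<Sum>i<n. \<beta> i)"
      using x by (intro sum_subtractf_nat) auto
    then show ?case using x by (auto simp: multi_indices_def)
  next
    case (3 x)
    then show ?case by (auto simp: index_add_def multi_indices_def PiE_iff extensional_def fun_eq_iff)
  next
    case (4 x)
    then show ?case by (auto intro: index_add_mem) (auto simp: index_add_def)
  next
    case (5 x)
    then show ?case by (auto simp: index_add_def multi_indices_def PiE_iff extensional_def fun_eq_iff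
          intro!: arg_cong[where f = "\<lambda>a. F a _"])
  qed
  also have "\<dots> = (\<Sum>\<beta>\<in>multi_indices n k. \<Sum>\<gamma>\<in>multi_indices n l. F (index_add n \<beta> \<gamma>) \<beta>)"
    by (rule sum.cartesian_product[symmetric])
  finally show ?thesis .
qed

text \<open>A discrete Cauchy formula: the \<open>k\<close>-th Fourier coefficient in
  \<open>u\<close> of the polynomial at \<open>z + t * u * w\<close> is its part of degree
  \<open>k\<close> in \<open>w\<close>, scaled by \<open>t ^ k\<close>.\<close>

lemma taylor_average:
  assumes N: "k + l < N"
  shows "(\<Sum>u\<in>{u. u ^ N = 1}. cnj (u ^ k) *\<^sub>C
      (\<Sum>\<alpha>\<in>multi_indices n (k + l). monomial n \<alpha> (\<lambda>i. z i + t * u * w i) *\<^sub>C c \<alpha>))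
    = (N * t ^ k) *\<^sub>C (\<Sum>\<beta>\<in>multi_indices n k. monomial n \<beta> w *\<^sub>C taylor_coeff n l c z \<beta>)"
proof -
  let ?U = "{u::complex. u ^ N = 1}"
  let ?B = "\<lambda>\<alpha>. {\<beta> \<in> multi_indices n k. \<forall>i<n. \<beta> i \<le> \<alpha> i}"
  let ?T = "\<lambda>\<alpha> \<beta>. of_nat (index_choose n \<alpha> \<beta>) * monomial n \<beta> w * (\<Prod>i<n. z i ^ (\<alpha> i - \<beta> i))"
  have "(\<Sum>u\<in>?U. cnj (u ^ k) *\<^sub>C
      (\<Sum>\<alpha>\<in>multi_indices n (k + l). monomial n \<alpha> (\<lambda>i. z i + t * u * w i) *\<^sub>C c \<alpha>))
    = (\<Sum>\<alpha>\<in>multi_indices n (k + l). (\<Sum>u\<in>?U. cnj (u ^ k) * monomial n \<alpha> (\<lambda>i. z i + t * u * w i)) *\<^sub>C c \<alpha>)"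
    unfolding scaleC_sum_right scaleC_sum_left scaleC_scaleC by (rule sum.swap)
  also have "\<dots> = (\<Sum>\<alpha>\<in>multi_indices n (k + l). (N * t ^ k) *\<^sub>C (\<Sum>\<beta>\<in>?B \<alpha>. ?T \<alpha> \<beta> *\<^sub>C c \<alpha>))"
  proof (intro sum.cong refl)
    fix \<alpha> assume \<alpha>: "\<alpha> \<in> multi_indices n (k + l)"
    have k: "k < N" using N by simp
    have "(\<Sum>u\<in>?U. cnj (u ^ k) * monomial n \<alpha> (\<lambda>i. z i + t * u * w i)) *\<^sub>C c \<alpha>
        = (N * t ^ k) *\<^sub>C (\<Sum>\<beta>\<in>?B \<alpha>. ?T \<alpha> \<beta>) *\<^sub>C c \<alpha>"
      unfolding monomial_add_average[OF \<alpha> N k] scaleC_scaleC ..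
    then show "(\<Sum>u\<in>?U. cnj (u ^ k) * monomial n \<alpha> (\<lambda>i. z i + t * u * w i)) *\<^sub>C c \<alpha>
        = (N * t ^ k) *\<^sub>C (\<Sum>\<beta>\<in>?B \<alpha>. ?T \<alpha> \<beta> *\<^sub>C c \<alpha>)"
      unfolding scaleC_sum_left .
  qed
  also have "\<dots> = (N * t ^ k) *\<^sub>C (\<Sum>\<beta>\<in>multi_indices n k. \<Sum>\<gamma>\<in>multi_indices n l.
      ?T (index_add n \<beta> \<gamma>) \<beta> *\<^sub>C c (index_add n \<beta> \<gamma>))"
    unfolding scaleC_sum_right[symmetric] sum_index_add_reindex[of "\<lambda>\<alpha> \<beta>. ?T \<alpha> \<beta> *\<^sub>C c \<alpha>"] ..
  also have "(\<Sum>\<beta>\<in>multi_indices n k. \<Sum>\<gamma>\<in>multi_indices n l.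
      ?T (index_add n \<beta> \<gamma>) \<beta> *\<^sub>C c (index_add n \<beta> \<gamma>))
    = (\<Sum>\<beta>\<in>multi_indices n k. monomial n \<beta> w *\<^sub>C taylor_coeff n l c z \<beta>)"
    unfolding taylor_coeff_def scaleC_sum_right scaleC_scaleC
    by (intro sum.cong refl arg_cong2[of _ _ _ _ scaleC]) (auto simp: monomial_def index_add_def mult_ac)
  finally show ?thesis .
qed

section \<open>Supremum norm on the polydisc and Cauchy's estimate\<close>

lemma polydisc_norm_upper:
  assumes P: "homogeneous_polynomial_with_coeffs n m c P" and z: "z \<in> polydisc n"
  shows "norm (P z) \<le> polydisc_norm n P"
proof -
  have "norm (P z) \<le> (\<Sum>\<alpha>\<in>multi_indices n m. norm (c \<alpha>))" if "z \<in> polydisc n" for z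
  proof -
    have "P z = (\<Sum>\<alpha>\<in>multi_indices n m. monomial n \<alpha> z *\<^sub>C c \<alpha>)"
      using P that by (simp add: homogeneous_polynomial_with_coeffs_def polydisc_def monomial_def)
    also have "norm \<dots> \<le> (\<Sum>\<alpha>\<in>multi_indices n m. cmod (monomial n \<alpha> z) * norm (c \<alpha>))"
      by (rule order_trans[OF norm_sum]) (simp add: norm_scaleC)
    also have "\<dots> \<le> (\<Sum>\<alpha>\<in>multi_indices n m. 1 * norm (c \<alpha>))"
      using that by (intro sum_mono mult_right_mono norm_monomial_le_1) (auto simp: polydisc_def)
    finally show ?thesis by simp
  qed
  then have "bdd_above ((\<lambda>z. norm (P z)) ` polydisc n)"
    by (intro bdd_aboveI2)
  then show ?thesis
    unfolding polydisc_norm_def using z by (intro cSUP_upper) auto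
qed

lemma polydisc_zero: "(\<lambda>i\<in>{..<n}. 0) \<in> polydisc n"
  by (auto simp: polydisc_def complex_space_def)

lemma polydisc_norm_nonneg:
  "homogeneous_polynomial_with_coeffs n m c P \<Longrightarrow> 0 \<le> polydisc_norm n P"
  using polydisc_norm_upper[OF _ polydisc_zero] norm_ge_zero order_trans by blast

text \<open>The points \<open>z + t * u * w\<close> lie in the polydisc of radius
  \<open>1 + t\<close>, where homogeneity bounds the polynomial by \<open>(1 + t) ^ (k + l)\<close>
  times its norm. The average over \<open>u\<close> does not exceed this, and dividing by
  \<open>t ^ k\<close> isolates the Taylor part.\<close>

lemma polydisc_norm_taylor:
  assumes P: "homogeneous_polynomial_with_coeffs n (k + l) c P"
    and z: "\<And>i. i < n \<Longrightarrow> cmod (z i) \<le> 1" and t: "0 < t"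
  shows "polydisc_norm n (\<lambda>w. \<Sum>\<beta>\<in>multi_indices n k. monomial n \<beta> w *\<^sub>C taylor_coeff n l c z \<beta>)
    \<le> (1 / t) ^ k * (1 + t) ^ (k + l) * polydisc_norm n P"
  unfolding polydisc_norm_def[of n "\<lambda>w. \<Sum>\<beta>\<in>multi_indices n k. monomial n \<beta> w *\<^sub>C taylor_coeff n l c z \<beta>"]
proof (rule cSUP_least)
  show "polydisc n \<noteq> {}" using polydisc_zero by blast
  fix w assume w: "w \<in> polydisc n"
  define N where "N = k + l + 1"
  have N: "k + l < N" "0 < N" by (auto simp: N_def)
  let ?U = "{u::complex. u ^ N = 1}"
  \<comment> \<open>The rescaled point lies in the open polydisc even when \<open>z\<close> is on
    the torus, because \<open>cmod (w i) < 1\<close> and \<open>t\<close> is positive.\<close>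
  define y where "y u = (\<lambda>i\<in>{..<n}. (z i + t * u * w i) / (1 + t))" for u :: complex
  let ?G = "\<Sum>\<beta>\<in>multi_indices n k. monomial n \<beta> w *\<^sub>C taylor_coeff n l c z \<beta>"
  have n1: "cmod (1 + complex_of_real t) = 1 + t"
    using norm_of_real_add1[of t, where 'a = complex] t by (simp add: add.commute)
  have y: "y u \<in> polydisc n" if "u \<in> ?U" for u :: complex
  proof -
    have "cmod ((z i + t * u * w i) / (1 + t)) < 1" if "i < n" for i
    proof -
      have "cmod (z i + t * u * w i) \<le> cmod (z i) + t * cmod (w i)"
        using norm_triangle_ineq[of "z i" "t * u * w i"] norm_root_of_unity[of u N] \<open>u \<in> ?U\<close> N t
        by (simp add: norm_mult)
      also have "\<dots> < 1 + t"
        using z[OF that] w t that by (intro add_le_less_mono) (auto simp: polydisc_def)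
      also have "\<dots> = cmod (1 + of_real t)" by (simp only: n1)
      finally show ?thesis using t by (simp add: norm_divide divide_less_eq_1)
    qed
    then show ?thesis by (auto simp: y_def polydisc_def complex_space_def)
  qed
  have val: "(\<Sum>\<alpha>\<in>multi_indices n (k + l). monomial n \<alpha> (\<lambda>i. z i + t * u * w i) *\<^sub>C c \<alpha>)
    = (1 + complex_of_real t) ^ (k + l) *\<^sub>C P (y u)" if "u \<in> ?U" for u :: complex
  proof -
    have "1 + complex_of_real t \<noteq> 0" using n1 t by auto
    then have "monomial n \<alpha> (\<lambda>i. z i + t * u * w i) = monomial n \<alpha> (\<lambda>i. (1 + complex_of_real t) * y u i)" for \<alpha>
      by (intro monomial_cong) (simp add: y_def)
    then have "(\<Sum>\<alpha>\<in>multi_indices n (k + l). monomial n \<alpha> (\<lambda>i. z i + t * u * w i) *\<^sub>C c \<alpha>)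
      = (1 + complex_of_real t) ^ (k + l) *\<^sub>C (\<Sum>\<alpha>\<in>multi_indices n (k + l). monomial n \<alpha> (y u) *\<^sub>C c \<alpha>)"
      unfolding scaleC_sum_right scaleC_scaleC by (intro sum.cong refl) (simp add: monomial_scale)
    also have "(\<Sum>\<alpha>\<in>multi_indices n (k + l). monomial n \<alpha> (y u) *\<^sub>C c \<alpha>) = P (y u)"
      using P y[OF that] by (simp add: homogeneous_polynomial_with_coeffs_def polydisc_def monomial_def)
    finally show ?thesis .
  qed
  have "N * t ^ k * norm ?G = norm ((N * complex_of_real t ^ k) *\<^sub>C ?G)"
    using t by (simp add: norm_scaleC norm_mult norm_power)
  also have "\<dots> = norm (\<Sum>u\<in>?U. cnj (u ^ k) *\<^sub>C (1 + complex_of_real t) ^ (k + l) *\<^sub>C P (y u))"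
    unfolding taylor_average[OF N(1), symmetric] 
    by (intro arg_cong[where f = norm] sum.cong refl arg_cong2[where f = scaleC]) (rule val)
  also have "\<dots> \<le> (\<Sum>u\<in>?U. (1 + t) ^ (k + l) * polydisc_norm n P)"
  proof (rule sum_norm_le)
    fix u assume u: "u \<in> ?U"
    then have "cmod u = 1" using norm_root_of_unity N by blast
    then have "norm (cnj (u ^ k) *\<^sub>C (1 + complex_of_real t) ^ (k + l) *\<^sub>C P (y u)) = (1 + t) ^ (k + l) * norm (P (y u))"
      by (simp add: norm_scaleC norm_power n1)
    also have "\<dots> \<le> (1 + t) ^ (k + l) * polydisc_norm n P"
      using t polydisc_norm_upper[OF P y[OF u]] by (intro mult_left_mono) auto
    finally show "norm (cnj (u ^ k) *\<^sub>C (1 + complex_of_real t) ^ (k + l) *\<^sub>C P (y u))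
      \<le> (1 + t) ^ (k + l) * polydisc_norm n P" .
  qed
  also have "\<dots> = N * ((1 + t) ^ (k + l) * polydisc_norm n P)"
    using card_roots_unity_eq[of N] N by simp
  finally have "t ^ k * norm ?G \<le> (1 + t) ^ (k + l) * polydisc_norm n P"
    using N by (simp add: mult.assoc)
  then show "norm ?G \<le> (1 / t) ^ k * (1 + t) ^ (k + l) * polydisc_norm n P"
    using t by (simp add: field_simps power_divide)
qed

lemma one_le_index_choose_index_add: "1 \<le> index_choose n (index_add n \<beta> \<gamma>) \<beta>"
  unfolding index_choose_def by (intro prod_ge_1) (auto simp: index_add_def Suc_leI)

section \<open>Bohnenblust--Hille inequalities\<close>

text \<open>Both sides are kept as \<open>p\<close>-th powers so that instances for different
  polynomials can be averaged; \<open>C\<close> must serve every dimension \<open>n\<close>.\<close>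

definition bohnenblust_hille ::
  "(('a \<Rightarrow> complex) \<Rightarrow> real) \<Rightarrow> ('y::complex_normed_vector \<Rightarrow> 'a \<Rightarrow> complex) \<Rightarrow> real \<Rightarrow> nat \<Rightarrow> real \<Rightarrow> bool"
  where "bohnenblust_hille nrm v p m C \<longleftrightarrow>
    (\<forall>n P c. homogeneous_polynomial_with_coeffs n m c P \<longrightarrow>
      (\<Sum>\<alpha>\<in>multi_indices n m. nrm (v (c \<alpha>)) powr p) \<le> (C * polydisc_norm n P) powr p)"

definition bh_exponent :: "real \<Rightarrow> nat \<Rightarrow> real"
  where "bh_exponent r m = 2 * real m * r / (2 + (real m - 1) * r)"

lemma bh_exponent_1 [simp]: "bh_exponent r (Suc 0) = r"
  by (simp add: bh_exponent_def)

lemma bh_exponent_denominator_pos: "1 \<le> r \<Longrightarrow> 1 \<le> m \<Longrightarrow> 0 < 2 + (real m - 1) * r"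
  by (intro add_pos_nonneg mult_nonneg_nonneg) auto

text \<open>The excess of the reciprocal over one half is proportional to \<open>1 / m\<close>,
  which is the relation between the exponents of degrees \<open>k\<close> and \<open>m\<close> that
  \<open>blei\<close> requires.\<close>

lemma inverse_bh_exponent:
  "1 \<le> r \<Longrightarrow> 1 \<le> m \<Longrightarrow> 1 / bh_exponent r m = 1 / 2 + (1 / r - 1 / 2) / m"
  using bh_exponent_denominator_pos[of r m] by (simp add: bh_exponent_def field_simps)

lemma bh_exponent_bounds:
  assumes "1 \<le> r" "r < 2" "1 \<le> m"
  shows "1 \<le> bh_exponent r m" "bh_exponent r m < 2"
proof -
  note d = bh_exponent_denominator_pos[OF assms(1,3)]
  have "2 + (real m - 1) * r \<le> 2 * real m * r"
  proof -
    have "2 * 1 \<le> (real m + 1) * r" using assms by (intro mult_mono) auto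
    then show ?thesis by (simp add: algebra_simps)
  qed
  then show "1 \<le> bh_exponent r m" using d by (simp add: bh_exponent_def)
  show "bh_exponent r m < 2" using d assms by (simp add: bh_exponent_def field_simps)
qed

lemma bounded_linear_scaleC_sum:
  assumes "bounded_linear \<phi>" "\<forall>a x. \<phi> (a *\<^sub>C x) = a * \<phi> x"
  shows "\<phi> (\<Sum>j\<in>J. a j *\<^sub>C x j) = (\<Sum>j\<in>J. a j * \<phi> (x j))"
  using assms by (simp add: linear_sum bounded_linear.linear)

text \<open>Multi-indices of degree one are unit vectors, so the phase of each variable can be
  chosen separately to make every term of \<open>\<phi> (P z)\<close> nonnegative.\<close>

lemma dual_sum_le_polydisc_norm:
  fixes c :: "(nat \<Rightarrow> nat) \<Rightarrow> 'y::complex_normed_vector"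
  assumes P: "homogeneous_polynomial_with_coeffs n 1 c P" and \<phi>: "\<phi> \<in> dual_unit_ball"
  shows "(\<Sum>\<alpha>\<in>multi_indices n 1. cmod (\<phi> (c \<alpha>))) \<le> polydisc_norm n P"
proof (rule field_le_mult_one_interval)
  \<comment> \<open>The aligned point may have coordinates of modulus one; shrinking by
    \<open>s < 1\<close> keeps it in the open polydisc.\<close>
  fix s :: real assume s: "0 < s" "s < 1"
  define e :: "nat \<Rightarrow> nat \<Rightarrow> nat" where "e i = (\<lambda>j\<in>{..<n}. if j = i then 1 else 0)" for i
  define z where "z = (\<lambda>i\<in>{..<n}. s * cnj (sgn (\<phi> (c (e i)))))"
  have z: "z \<in> polydisc n"
    using s by (auto simp: z_def polydisc_def complex_space_def norm_mult norm_sgn)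
  have mon: "monomial n \<alpha> z = s * cnj (sgn (\<phi> (c \<alpha>)))" if \<alpha>: "\<alpha> \<in> multi_indices n 1" for \<alpha>
  proof -
    have "(\<Sum>i<n. \<alpha> i) = 1" using \<alpha> by (simp add: multi_indices_def)
    then obtain i where i: "i < n" "\<alpha> i = 1" "\<And>j. j < n \<Longrightarrow> i \<noteq> j \<Longrightarrow> \<alpha> j = 0"
      by (subst (asm) sum_eq_1_iff) auto
    have "\<alpha> = e i"
    proof (rule multi_indices_eqI[OF \<alpha>])
      show "e i \<in> multi_indices n 1" using i by (simp add: multi_indices_def e_def)
    qed (use i in \<open>auto simp: e_def\<close>)
    moreover have "monomial n (e i) z = (\<Prod>j<n. if j = i then z j else 1)"
      unfolding monomial_def by (intro prod.cong) (auto simp: e_def)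
    ultimately show ?thesis using i by (simp add: z_def)
  qed
  have cnj_sgn: "cnj (sgn x) * x = cmod x" for x
  proof (cases "x = 0")
    case False
    have "cnj (sgn x) * x = complex_of_real ((cmod x)\<^sup>2) / complex_of_real (cmod x)"
      by (simp only: sgn_eq complex_norm_square) simp
    then show ?thesis using False by (simp add: power2_eq_square)
  qed simp
  have lin: "bounded_linear \<phi>" "\<forall>a x. \<phi> (a *\<^sub>C x) = a * \<phi> x" "onorm \<phi> \<le> 1"
    using \<phi> by (auto simp: dual_unit_ball_def)
  have "P z = (\<Sum>\<alpha>\<in>multi_indices n 1. monomial n \<alpha> z *\<^sub>C c \<alpha>)"
    using P z by (simp add: homogeneous_polynomial_with_coeffs_def polydisc_def monomial_def)
  then have "\<phi> (P z) = (\<Sum>\<alpha>\<in>multi_indices n 1. monomial n \<alpha> z * \<phi> (c \<alpha>))"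
    using bounded_linear_scaleC_sum[OF lin(1,2)] by simp
  also have "\<dots> = (\<Sum>\<alpha>\<in>multi_indices n 1. of_real (s * cmod (\<phi> (c \<alpha>))))"
    by (intro sum.cong refl) (simp add: mon mult.assoc cnj_sgn)
  finally have "\<phi> (P z) = of_real (s * (\<Sum>\<alpha>\<in>multi_indices n 1. cmod (\<phi> (c \<alpha>))))"
    by (simp add: sum_distrib_left)
  then have "cmod (\<phi> (P z)) = \<bar>s * (\<Sum>\<alpha>\<in>multi_indices n 1. cmod (\<phi> (c \<alpha>)))\<bar>"
    by (simp only: norm_of_real)
  then have "s * (\<Sum>\<alpha>\<in>multi_indices n 1. cmod (\<phi> (c \<alpha>))) \<le> cmod (\<phi> (P z))"
    by simp
  also have "\<dots> \<le> onorm \<phi> * norm (P z)" by (rule onorm[OF lin(1)])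
  also have "\<dots> \<le> 1 * norm (P z)" using lin(3) by (intro mult_right_mono) auto
  also have "\<dots> \<le> polydisc_norm n P" using polydisc_norm_upper[OF P z] by simp
  finally show "s * (\<Sum>\<alpha>\<in>multi_indices n 1. cmod (\<phi> (c \<alpha>))) \<le> polydisc_norm n P" .
qed

section \<open>Linearity of the operator and the inequality in degree one\<close>

context banach_function_space
begin

lemma operator_sum:
  fixes v :: "'y::complex_normed_vector \<Rightarrow> 'a \<Rightarrow> complex"
  assumes v: "bounded_operator_into M X nrm v" and J: "finite J"
  shows "AE \<omega> in M. v (\<Sum>j\<in>J. a j *\<^sub>C y j) \<omega> = (\<Sum>j\<in>J. a j * v (y j) \<omega>)"
  using J
proof induction
  case empty
  have "AE \<omega> in M. v (0 *\<^sub>C 0) \<omega> = 0 * v 0 \<omega>"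
    using v unfolding bounded_operator_into_def by blast
  then show ?case by simp
next
  case (insert i J)
  have "AE \<omega> in M. v (a i *\<^sub>C y i + (\<Sum>j\<in>J. a j *\<^sub>C y j)) \<omega> = v (a i *\<^sub>C y i) \<omega> + v (\<Sum>j\<in>J. a j *\<^sub>C y j) \<omega>"
    "AE \<omega> in M. v (a i *\<^sub>C y i) \<omega> = a i * v (y i) \<omega>"
    using v unfolding bounded_operator_into_def by blast+
  then show ?case using insert by auto
qed

lemma nrm_operator_scale:
  assumes "bounded_operator_into M X nrm v"
  shows "nrm (v (a *\<^sub>C y)) = cmod a * nrm (v y)"
proof -
  have mem: "\<And>y. v y \<in> X" and "AE \<omega> in M. v (a *\<^sub>C y) \<omega> = a * v y \<omega>"
    using assms unfolding bounded_operator_into_def by blast+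
  then have "nrm (v (a *\<^sub>C y)) = nrm (\<lambda>\<omega>. a * v y \<omega>)" by (intro nrm_cong scale_closed)
  then show ?thesis by (simp add: norm_scale mem)
qed

lemma bohnenblust_hille_1:
  fixes v :: "'y::complex_normed_vector \<Rightarrow> 'a \<Rightarrow> complex"
  assumes v: "r1_summing r M X nrm v" and r: "1 \<le> r"
  shows "\<exists>C>0. bohnenblust_hille nrm v r 1 C"
proof -
  obtain C where C: "C > 0" "\<And>N x. (\<Sum>i<N. nrm (v (x i)) powr r) powr (1 / r)
      \<le> C * (SUP \<phi>\<in>dual_unit_ball. \<Sum>i<(N::nat). cmod (\<phi> (x i)))"
    using v unfolding r1_summing_def by blast
  have "(\<Sum>\<alpha>\<in>multi_indices n 1. nrm (v (c \<alpha>)) powr r) \<le> (C * polydisc_norm n P) powr r"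
    if P: "homogeneous_polynomial_with_coeffs n 1 c P" for n P and c :: "(nat \<Rightarrow> nat) \<Rightarrow> 'y"
  proof -
    let ?I = "multi_indices n 1"
    obtain h where h: "bij_betw h {..<card ?I} ?I"
      using ex_bij_betw_nat_finite[OF finite_multi_indices, of n 1] by (auto simp: atLeast0LessThan)
    have s: "(\<Sum>i<card ?I. F (h i)) = sum F ?I" for F :: "_ \<Rightarrow> real"
      by (rule sum.reindex_bij_betw[OF h])
    \<comment> \<open>The dual ball must be nonempty for its supremum to be bounded by a common
      upper bound.\<close>
    have "(\<lambda>x. 0) \<in> (dual_unit_ball :: ('y \<Rightarrow> complex) set)"
      by (simp add: dual_unit_ball_def onorm_zero)
    then have "(SUP \<phi>\<in>dual_unit_ball. \<Sum>i<card ?I. cmod (\<phi> (c (h i)))) \<le> polydisc_norm n P"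
      using dual_sum_le_polydisc_norm[OF P] s[of "\<lambda>\<alpha>. cmod (_ (c \<alpha>))"]
      by (intro cSUP_least) auto
    then have "C * (SUP \<phi>\<in>dual_unit_ball. \<Sum>i<card ?I. cmod (\<phi> (c (h i)))) \<le> C * polydisc_norm n P"
      using C(1) by simp
    with C(2)[where N = "card ?I" and x = "\<lambda>i. c (h i)"]
    have "(\<Sum>\<alpha>\<in>?I. nrm (v (c \<alpha>)) powr r) powr (1 / r) \<le> C * polydisc_norm n P"
      unfolding s[of "\<lambda>\<alpha>. nrm (v (c \<alpha>)) powr r"] by (rule order_trans)
    then have "((\<Sum>\<alpha>\<in>?I. nrm (v (c \<alpha>)) powr r) powr (1 / r)) powr r \<le> (C * polydisc_norm n P) powr r"
      using r by (intro powr_mono2) auto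
    then show ?thesis using r by (simp add: powr_powr sum_nonneg)
  qed
  then show ?thesis using C(1) unfolding bohnenblust_hille_def by blast
qed

end

section \<open>Raising the degree\<close>

context hilbertian_function_space
begin

text \<open>For each \<open>\<beta>\<close>, hypercontractivity bounds the inner sum by the mean
  over \<open>z\<close> of the \<open>p\<close>-th powers of the norms of
  \<open>v (taylor_coeff n l c z \<beta>)\<close>. After interchanging sum and mean, the inequality
  of degree \<open>k\<close> applies for each \<open>z\<close>, and
  \<open>polydisc_norm_taylor\<close> bounds the polynomial involved.\<close>

lemma mixed_coefficient_sum_le:
  fixes v :: "'y::complex_normed_vector \<Rightarrow> 'a \<Rightarrow> complex"
  assumes v: "bounded_operator_into M X nrm v"
    and bh: "bohnenblust_hille nrm v p k C" "0 \<le> C"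
    and p: "0 < p" "p < 2" and t: "0 < t"
    and P: "homogeneous_polynomial_with_coeffs n (k + l) c P"
  shows "(\<Sum>\<beta>\<in>multi_indices n k.
      (\<Sum>\<gamma>\<in>multi_indices n l. (nrm (v (c (index_add n \<beta> \<gamma>))))\<^sup>2) powr (p / 2))
    \<le> D ^ 4 * 2 powr ((2 - p) * l) * (C * ((1 / t) ^ k * (1 + t) ^ (k + l) * polydisc_norm n P)) powr p"
proof -
  have vX: "v y \<in> X" for y using v by (simp add: bounded_operator_into_def)
  define N where "N = 2 * l + 1"
  let ?Z = "torus N n"
  define K where "K = D ^ 4 * 2 powr ((2 - p) * l)"
  have K: "0 \<le> K" using D by (simp add: K_def)
  define Q where "Q = C * ((1 / t) ^ k * (1 + t) ^ (k + l) * polydisc_norm n P)"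
  have cardZ: "0 < card ?Z" by (simp add: card_torus N_def)
  have "(\<Sum>\<gamma>\<in>multi_indices n l. (nrm (v (c (index_add n \<beta> \<gamma>))))\<^sup>2) powr (p / 2)
    \<le> K * ((\<Sum>z\<in>?Z. nrm (v (taylor_coeff n l c z \<beta>)) powr p) / card ?Z)"
    if \<beta>: "\<beta> \<in> multi_indices n k" for \<beta>
  proof -
    define x where "x \<gamma> = v (of_nat (index_choose n (index_add n \<beta> \<gamma>) \<beta>) *\<^sub>C c (index_add n \<beta> \<gamma>))" for \<gamma>
    \<comment> \<open>Taylor coefficients carry binomial factors; these are at least one, so
      inserting them only enlarges the norms.\<close>
    have "(nrm (v (c (index_add n \<beta> \<gamma>))))\<^sup>2 \<le> (nrm (x \<gamma>))\<^sup>2" for \<gamma>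
    proof (rule power_mono)
      have "1 * nrm (v (c (index_add n \<beta> \<gamma>)))
        \<le> real (index_choose n (index_add n \<beta> \<gamma>) \<beta>) * nrm (v (c (index_add n \<beta> \<gamma>)))"
        using one_le_index_choose_index_add nrm_nonneg[OF vX] by (intro mult_right_mono) auto
      then show "nrm (v (c (index_add n \<beta> \<gamma>))) \<le> nrm (x \<gamma>)"
        by (simp add: x_def nrm_operator_scale[OF v])
    qed (simp add: nrm_nonneg vX)
    then have "(\<Sum>\<gamma>\<in>multi_indices n l. (nrm (v (c (index_add n \<beta> \<gamma>))))\<^sup>2) powr (p / 2)
      \<le> (\<Sum>\<gamma>\<in>multi_indices n l. (nrm (x \<gamma>))\<^sup>2) powr (p / 2)"
      using p by (intro powr_mono2 sum_mono) (auto simp: sum_nonneg)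
    also have "\<dots> \<le> K * ((\<Sum>z\<in>?Z. nrm (\<lambda>\<omega>. \<Sum>\<gamma>\<in>multi_indices n l. monomial n \<gamma> z * x \<gamma> \<omega>) powr p) / card ?Z)"
      unfolding K_def using p vX
      by (intro vector_hypercontractive[OF order_refl]) (auto simp: N_def x_def)
    also have "(\<Sum>z\<in>?Z. nrm (\<lambda>\<omega>. \<Sum>\<gamma>\<in>multi_indices n l. monomial n \<gamma> z * x \<gamma> \<omega>) powr p)
      = (\<Sum>z\<in>?Z. nrm (v (taylor_coeff n l c z \<beta>)) powr p)"
    proof (intro sum.cong refl arg_cong2[where f = "(powr)"] nrm_cong)
      fix z
      show "AE \<omega> in M. (\<Sum>\<gamma>\<in>multi_indices n l. monomial n \<gamma> z * x \<gamma> \<omega>) = v (taylor_coeff n l c z \<beta>) \<omega>"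
        using operator_sum[OF v finite_multi_indices, where a = "\<lambda>\<gamma>. monomial n \<gamma> z"]
        unfolding taylor_coeff_def x_def by (simp only: eq_commute)
      show "(\<lambda>\<omega>. \<Sum>\<gamma>\<in>multi_indices n l. monomial n \<gamma> z * x \<gamma> \<omega>) \<in> X"
        using vX by (intro sum_mem scale_closed) (simp add: x_def)
    qed (rule vX)
    finally show ?thesis .
  qed
  then have "(\<Sum>\<beta>\<in>multi_indices n k.
      (\<Sum>\<gamma>\<in>multi_indices n l. (nrm (v (c (index_add n \<beta> \<gamma>))))\<^sup>2) powr (p / 2))
    \<le> (\<Sum>\<beta>\<in>multi_indices n k. K * ((\<Sum>z\<in>?Z. nrm (v (taylor_coeff n l c z \<beta>)) powr p) / card ?Z))"
    by (rule sum_mono)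
  also have "\<dots> = K * ((\<Sum>z\<in>?Z. \<Sum>\<beta>\<in>multi_indices n k. nrm (v (taylor_coeff n l c z \<beta>)) powr p) / card ?Z)"
    by (subst sum.swap) (simp add: sum_distrib_left sum_divide_distrib)
  also have "\<dots> \<le> K * ((\<Sum>z\<in>?Z. Q powr p) / card ?Z)"
  proof (intro mult_left_mono divide_right_mono sum_mono)
    fix z assume z: "z \<in> ?Z"
    define G where "G = (\<lambda>w. \<Sum>\<beta>\<in>multi_indices n k. monomial n \<beta> w *\<^sub>C taylor_coeff n l c z \<beta>)"
    have G: "homogeneous_polynomial_with_coeffs n k (taylor_coeff n l c z) G"
      by (simp add: homogeneous_polynomial_with_coeffs_def G_def monomial_def)
    have "(\<Sum>\<beta>\<in>multi_indices n k. nrm (v (taylor_coeff n l c z \<beta>)) powr p) \<le> (C * polydisc_norm n G) powr p"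
      using bh(1) G unfolding bohnenblust_hille_def by blast
    also have "\<dots> \<le> Q powr p"
      unfolding Q_def G_def
    proof (intro powr_mono2 mult_left_mono polydisc_norm_taylor P t bh(2) mult_nonneg_nonneg)
      show "0 \<le> polydisc_norm n (\<lambda>w. \<Sum>\<beta>\<in>multi_indices n k. monomial n \<beta> w *\<^sub>C taylor_coeff n l c z \<beta>)"
        using polydisc_norm_nonneg[OF G] by (simp add: G_def)
      show "cmod (z i) \<le> 1" if "i < n" for i
        using norm_torus[OF z _ that] by (simp add: N_def)
    qed (use p in simp)
    finally show "(\<Sum>\<beta>\<in>multi_indices n k. nrm (v (taylor_coeff n l c z \<beta>)) powr p) \<le> Q powr p" .
  qed (use K in auto)
  also have "\<dots> = K * Q powr p" using cardZ by simp
  finally show ?thesis by (simp add: K_def Q_def)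
qed

lemma bohnenblust_hille_step:
  fixes v :: "'y::complex_normed_vector \<Rightarrow> 'a \<Rightarrow> complex"
  assumes v: "bounded_operator_into M X nrm v"
    and bh: "bohnenblust_hille nrm v p k C" "0 \<le> C"
    and k: "1 \<le> k" and p: "1 \<le> p" "p < 2" and t: "0 < t"
    and \<rho>: "0 < \<rho>" "1 / \<rho> - 1 / 2 = k / (k + l) * (1 / p - 1 / 2)"
  shows "bohnenblust_hille nrm v \<rho> (k + l)
    (D ^ 4 * 2 powr ((2 - p) / p * l) * (C * ((1 / t) ^ k * (1 + t) ^ (k + l))))"
  unfolding bohnenblust_hille_def
proof (intro allI impI)
  fix n P and c :: "(nat \<Rightarrow> nat) \<Rightarrow> 'y"
  assume P: "homogeneous_polynomial_with_coeffs n (k + l) c P"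
  have vX: "v y \<in> X" for y using v by (simp add: bounded_operator_into_def)
  let ?V = "{..<k + l}"
  define F where "F \<alpha> = nrm (v (c \<alpha>))" for \<alpha>
  have F: "0 \<le> F \<alpha>" for \<alpha> by (simp add: F_def nrm_nonneg vX)
  define a where "a i = (if mono_on ?V i then F (count_index n ?V i) else 0)" for i
  define Q where "Q = C * ((1 / t) ^ k * (1 + t) ^ (k + l) * polydisc_norm n P)"
  define B where "B = D ^ 4 * 2 powr ((2 - p) * l) * Q powr p"
  have Q: "0 \<le> Q" using polydisc_norm_nonneg[OF P] bh(2) t by (simp add: Q_def)
  have "(\<Sum>\<alpha>\<in>multi_indices n (k + l). F \<alpha> powr \<rho>) \<le> (\<Sum>i\<in>?V \<rightarrow>\<^sub>E {..<n}. a i powr \<rho>)"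
    by (rule sum_multi_indices_le_blei_sum[OF a_def])
  also have "\<dots> \<le> B powr (\<rho> / p)"
  proof (rule blei[where k = k and m = "k + l"])
    fix S assume S: "S \<subseteq> ?V" "card S = k"
    have "(\<Sum>u\<in>S \<rightarrow>\<^sub>E {..<n}. (\<Sum>i\<in>{i \<in> ?V \<rightarrow>\<^sub>E {..<n}. restrict i S = u}. (a i)\<^sup>2) powr (p / 2))
      \<le> (\<Sum>\<beta>\<in>multi_indices n k. (\<Sum>\<gamma>\<in>multi_indices n (k + l - k). (F (index_add n \<beta> \<gamma>))\<^sup>2) powr (p / 2))"
      using p by (intro mixed_sum_le_multi_indices a_def S) auto
    also have "\<dots> \<le> B"
      using mixed_coefficient_sum_le[OF v bh _ p(2) t P] p by (simp add: F_def B_def Q_def)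
    finally show "(\<Sum>u\<in>S \<rightarrow>\<^sub>E {..<n}. (\<Sum>i\<in>{i \<in> ?V \<rightarrow>\<^sub>E {..<n}. restrict i S = u}. (a i)\<^sup>2) powr (p / 2)) \<le> B" .
  qed (use k p \<rho> F in \<open>auto simp: a_def\<close>)
  also have "\<dots> = (B powr (1 / p)) powr \<rho>" by (simp add: powr_powr)
  also have "\<dots> \<le> (D ^ 4 * 2 powr ((2 - p) / p * l) * Q) powr \<rho>"
  proof (rule powr_mono2)
    have "B powr (1 / p) = (D ^ 4) powr (1 / p) * 2 powr ((2 - p) / p * l) * Q"
      using D Q p by (simp add: B_def powr_mult powr_powr)
    also have "\<dots> \<le> D ^ 4 * 2 powr ((2 - p) / p * l) * Q"
    proof (intro mult_right_mono)
      \<comment> \<open>The \<open>p\<close>-th root of \<open>D ^ 4\<close> is replaced by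
        \<open>D ^ 4\<close> itself, as \<open>1 \<le> D\<close> and
        \<open>1 \<le> p\<close>.\<close>
      have "(D ^ 4) powr (1 / p) \<le> (D ^ 4) powr 1" using D p by (intro powr_mono) auto
      then show "(D ^ 4) powr (1 / p) \<le> D ^ 4" using D by simp
    qed (use Q in auto)
    finally show "B powr (1 / p) \<le> D ^ 4 * 2 powr ((2 - p) / p * l) * Q" .
  qed (use \<rho> in auto)
  finally show "(\<Sum>\<alpha>\<in>multi_indices n (k + l). nrm (v (c \<alpha>)) powr \<rho>)
    \<le> (D ^ 4 * 2 powr ((2 - p) / p * l) * (C * ((1 / t) ^ k * (1 + t) ^ (k + l))) * polydisc_norm n P) powr \<rho>"
    by (simp add: F_def Q_def mult.assoc)
qed

text \<open>With \<open>p = bh_exponent r k\<close>, the loss exponent \<open>(2 - p) / p\<close>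
  equals \<open>(2 / r - 1) / k\<close>, which is at most \<open>1 / k\<close> because
  \<open>1 \<le> r\<close>. So the hypercontractive loss is at most \<open>2 powr (m / k)\<close>,
  of small exponential rate for large \<open>k\<close>.\<close>

lemma bohnenblust_hille_bh_exponent_step:
  fixes v :: "'y::complex_normed_vector \<Rightarrow> 'a \<Rightarrow> complex"
  assumes v: "bounded_operator_into M X nrm v" and r: "1 \<le> r" "r < 2"
    and bh: "bohnenblust_hille nrm v (bh_exponent r k) k C" "0 \<le> C"
    and k: "1 \<le> k" "k \<le> m" and t: "0 < t"
  shows "bohnenblust_hille nrm v (bh_exponent r m) m
    (D ^ 4 * 2 powr (real m / real k) * (C * ((1 / t) ^ k * (1 + t) ^ m)))"
proof -
  let ?p = "bh_exponent r k"
  have m: "1 \<le> m" using k by simp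
  note p = bh_exponent_bounds[OF r k(1)] and \<rho> = bh_exponent_bounds[OF r m]
  obtain l where l: "m = k + l" using k(2) le_Suc_ex by blast
  have e: "1 / bh_exponent r m - 1 / 2 = k / (k + l) * (1 / ?p - 1 / 2)"
    unfolding inverse_bh_exponent[OF r(1) k(1)] inverse_bh_exponent[OF r(1) m] using k l by simp
  have *: "bohnenblust_hille nrm v (bh_exponent r m) m
    (D ^ 4 * 2 powr ((2 - ?p) / ?p * l) * (C * ((1 / t) ^ k * (1 + t) ^ m)))" (is "bohnenblust_hille _ _ _ _ ?C")
    using bohnenblust_hille_step[OF v bh k(1) p t _ e] \<rho> by (simp add: l)
  have "(2 - ?p) / ?p = 2 * (1 / ?p - 1 / 2)" using p by (simp add: field_simps)
  also have "\<dots> = (2 / r - 1) / k" unfolding inverse_bh_exponent[OF r(1) k(1)] by (simp add: algebra_simps diff_divide_distrib)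
  also have "\<dots> \<le> 1 / k" using r by (intro divide_right_mono) (auto simp: field_simps)
  finally have "(2 - ?p) / ?p * l \<le> 1 / k * m" using l by (intro mult_mono) auto
  then have le: "?C \<le> D ^ 4 * 2 powr (real m / real k) * (C * ((1 / t) ^ k * (1 + t) ^ m))"
    using D bh(2) t by (intro mult_right_mono mult_left_mono powr_mono) auto
  show ?thesis unfolding bohnenblust_hille_def
  proof (intro allI impI)
    fix n P and c :: "(nat \<Rightarrow> nat) \<Rightarrow> 'y"
    assume P: "homogeneous_polynomial_with_coeffs n m c P"
    have "(\<Sum>\<alpha>\<in>multi_indices n m. nrm (v (c \<alpha>)) powr bh_exponent r m) \<le> (?C * polydisc_norm n P) powr bh_exponent r m"
      using * P unfolding bohnenblust_hille_def by blast
    also have "\<dots> \<le> (D ^ 4 * 2 powr (real m / real k) * (C * ((1 / t) ^ k * (1 + t) ^ m)) * polydisc_norm n P) powr bh_exponent r m"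
    proof (rule powr_mono2)
      show "0 \<le> ?C * polydisc_norm n P"
        using polydisc_norm_nonneg[OF P] D bh(2) t by (intro mult_nonneg_nonneg) auto
    qed (use \<rho> in simp, rule mult_right_mono[OF le polydisc_norm_nonneg[OF P]])
    finally show "(\<Sum>\<alpha>\<in>multi_indices n m. nrm (v (c \<alpha>)) powr bh_exponent r m)
      \<le> (D ^ 4 * 2 powr (real m / real k) * (C * ((1 / t) ^ k * (1 + t) ^ m)) * polydisc_norm n P) powr bh_exponent r m" .
  qed
qed

end

lemma (in banach_function_space) ex_hilbertian_function_space:
  assumes "q_concave 2 X nrm" "p_convex 2 X nrm"
  shows "\<exists>D. hilbertian_function_space M X nrm D"
proof -
  obtain A where A: "A > 0" "\<And>N x. \<forall>i<N. x i \<in> X \<Longrightarrow>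
      (\<Sum>i<N. nrm (x i) powr 2) powr (1 / 2) \<le> A * nrm (lattice_sum 2 N x)"
    using assms(1) unfolding q_concave_def by blast
  obtain B where B: "B > 0" "\<And>N x. \<forall>i<N. x i \<in> X \<Longrightarrow>
      nrm (lattice_sum 2 N x) \<le> B * (\<Sum>i<N. nrm (x i) powr 2) powr (1 / 2)"
    using assms(2) unfolding p_convex_def by blast
  define D where "D = max 1 (max (A\<^sup>2) (B\<^sup>2))"
  have s: "(\<Sum>i<N. nrm (x i) powr 2) powr (1 / 2) = sqrt (\<Sum>i<N. (nrm (x i))\<^sup>2)"
    if "\<And>i. i < (N::nat) \<Longrightarrow> x i \<in> X" for N x
  proof -
    have "(\<Sum>i<N. nrm (x i) powr 2) = (\<Sum>i<N. (nrm (x i))\<^sup>2)"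
      using that nrm_nonneg by (intro sum.cong) auto
    then show ?thesis by (simp add: powr_half_sqrt sum_nonneg)
  qed
  have "hilbertian_function_space M X nrm D"
  proof
    show "1 \<le> D" by (simp add: D_def)
  next
    fix N and x :: "nat \<Rightarrow> 'a \<Rightarrow> complex" assume x: "\<And>i. i < N \<Longrightarrow> x i \<in> X"
    let ?S = "\<Sum>i<N. (nrm (x i))\<^sup>2" and ?q = "nrm (square_function {..<N} x)"
    have S: "0 \<le> ?S" by (simp add: sum_nonneg)
    have q: "0 \<le> ?q" using x by (intro nrm_nonneg square_function_mem) auto
    have "sqrt ?S \<le> A * ?q" using A(2)[of N x] x by (simp add: s lattice_sum_2)
    then have "(sqrt ?S)\<^sup>2 \<le> (A * ?q)\<^sup>2" using S by (intro power_mono) auto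
    then have "?S \<le> A\<^sup>2 * ?q\<^sup>2" using S by (simp add: power_mult_distrib)
    also have "\<dots> \<le> D * ?q\<^sup>2" by (intro mult_right_mono) (auto simp: D_def)
    finally show "?S \<le> D * ?q\<^sup>2" .
    have "?q \<le> B * sqrt ?S" using B(2)[of N x] x by (simp add: s lattice_sum_2)
    then have "?q\<^sup>2 \<le> (B * sqrt ?S)\<^sup>2" using q by (intro power_mono) auto
    then have "?q\<^sup>2 \<le> B\<^sup>2 * ?S" using S by (simp add: power_mult_distrib)
    also have "\<dots> \<le> D * ?S" using S by (intro mult_right_mono) (auto simp: D_def)
    finally show "?q\<^sup>2 \<le> D * ?S" .
  qed
  then show ?thesis by blast
qed

section \<open>Choice of the intermediate degree and of the radius in terms of
  \<open>\<epsilon>\<close>\<close>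

theorem corollary3p4:
  fixes M :: "'a measure"
    and X :: "('a \<Rightarrow> complex) set"
    and nrm :: "('a \<Rightarrow> complex) \<Rightarrow> real"
    and v :: "'y::complex_banach \<Rightarrow> 'a \<Rightarrow> complex"
    and r \<epsilon> :: real
  assumes "banach_function_space M X nrm"
    and "q_concave 2 X nrm"
    and "p_convex 2 X nrm"
    and "1 \<le> r" and "r < 2"
    and "r1_summing r M X nrm v"
    and "\<epsilon> > 0"
  shows "\<exists>\<kappa>>0. \<forall>(m::nat)\<ge>1. \<forall>(n::nat)\<ge>1. \<forall>P c.
    homogeneous_polynomial_with_coeffs n m c P \<longrightarrow>
    (\<Sum>\<alpha>\<in>multi_indices n m.
        nrm (v (c \<alpha>)) powr (2 * real m * r / (2 + (real m - 1) * r)))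
      powr ((2 + (real m - 1) * r) / (2 * real m * r))
    \<le> \<kappa> * (1 + \<epsilon>) ^ m * polydisc_norm n P"
proof -
  interpret banach_function_space M X nrm by fact
  note r = assms(4,5)
  obtain D where "hilbertian_function_space M X nrm D"
    using ex_hilbertian_function_space assms(2,3) by blast
  then interpret hilbertian_function_space M X nrm D .
  have v: "bounded_operator_into M X nrm v"
    using assms(6) by (simp add: r1_summing_def)
  obtain C1 where C1: "C1 > 0" "bohnenblust_hille nrm v r 1 C1"
    using bohnenblust_hille_1[OF assms(6) r(1)] by blast
  \<comment> \<open>One factor \<open>(1 + \<delta>) ^ m\<close> absorbs the hypercontractive loss,
    the other is the Cauchy factor at radius \<open>t = \<delta>\<close>; together they give
    \<open>(1 + \<epsilon>) ^ m\<close>.\<close>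
  define \<delta> where "\<delta> = sqrt (1 + \<epsilon>) - 1"
  have \<delta>: "0 < \<delta>" "(1 + \<delta>)\<^sup>2 = 1 + \<epsilon>" using assms(7) by (auto simp: \<delta>_def)
  \<comment> \<open>The constant obtained from degree one with \<open>t = 1\<close>. It grows
    exponentially in \<open>m\<close> and is used only for degrees up to \<open>k\<close>.\<close>
  define B where "B m = D ^ 4 * 2 powr real m * (C1 * (1 * (1 + 1) ^ m))" for m
  have Bpos: "0 < B m" for m using D C1 by (simp add: B_def)
  have B: "bohnenblust_hille nrm v (bh_exponent r m) m (B m)" if "1 \<le> m" for m
    using bohnenblust_hille_bh_exponent_step[OF v r, of 1 C1 m 1] C1 that by (simp add: B_def)
  have "0 < log 2 (1 + \<delta>)" using \<delta> by simp
  \<comment> \<open>This makes the loss per degree, \<open>2 powr (1 / k)\<close>, at most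
    \<open>1 + \<delta>\<close>.\<close>
  then obtain k0 where k0: "inverse (real (Suc k0)) < log 2 (1 + \<delta>)"
    using reals_Archimedean by blast
  define k where "k = Suc k0"
  have k: "1 \<le> k" and "1 / real k \<le> log 2 (1 + \<delta>)" using k0 by (auto simp: k_def field_simps)
  then have pk: "2 powr (1 / real k) \<le> 1 + \<delta>" using \<delta> by (simp add: le_log_iff)
  \<comment> \<open>The first summand covers the degrees up to \<open>k\<close>, the second those
    beyond, reached by a step from \<open>k\<close> with \<open>t = \<delta>\<close>. Neither
    depends on \<open>m\<close> or \<open>n\<close>.\<close>
  define \<kappa> where "\<kappa> = (\<Sum>m\<le>k. B m) + D ^ 4 * (B k * (1 / \<delta>) ^ k)"
  have tail_nonneg: "0 \<le> D ^ 4 * (B k * (1 / \<delta>) ^ k)"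
    using D \<delta> Bpos[of k] by simp
  have head: "B m \<le> (\<Sum>m\<le>k. B m)" if "m \<le> k" for m
    using that Bpos by (intro member_le_sum) (auto intro: less_imp_le)
  have "0 < \<kappa>" using head[of 0] Bpos[of 0] tail_nonneg unfolding \<kappa>_def by linarith
  moreover have "(\<Sum>\<alpha>\<in>multi_indices n m.
        nrm (v (c \<alpha>)) powr (2 * real m * r / (2 + (real m - 1) * r)))
      powr ((2 + (real m - 1) * r) / (2 * real m * r))
    \<le> \<kappa> * (1 + \<epsilon>) ^ m * polydisc_norm n P"
    if m: "1 \<le> m" and P: "homogeneous_polynomial_with_coeffs n m c P" for n m P c
  proof -
    let ?\<rho> = "bh_exponent r m"
    note \<rho> = bh_exponent_bounds[OF r m]
    obtain C where C: "bohnenblust_hille nrm v ?\<rho> m C" "0 \<le> C" "C \<le> \<kappa> * (1 + \<epsilon>) ^ m"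
    proof (cases "m \<le> k")
      case True
      have "B m \<le> \<kappa> * 1" using head[OF True] tail_nonneg by (simp add: \<kappa>_def)
      also have "\<dots> \<le> \<kappa> * (1 + \<epsilon>) ^ m"
        using \<open>0 < \<kappa>\<close> assms(7) by (intro mult_left_mono one_le_power) auto
      finally show ?thesis using that[OF B[OF m]] Bpos[of m] by simp
    next
      case False
      let ?C = "D ^ 4 * 2 powr (real m / real k) * (B k * ((1 / \<delta>) ^ k * (1 + \<delta>) ^ m))"
      have bh: "bohnenblust_hille nrm v ?\<rho> m ?C"
        using bohnenblust_hille_bh_exponent_step[OF v r B[OF k] _ k _ \<delta>(1), of m] False Bpos[of k]
        by (simp add: less_imp_le)
      have nonneg: "0 \<le> ?C" using D \<delta> Bpos[of k] by simp
      have "2 powr (real m / real k) = (2 powr (1 / real k)) ^ m"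
        by (simp add: powr_power)
      also have "\<dots> \<le> (1 + \<delta>) ^ m" using pk by (intro power_mono) auto
      finally have "?C \<le> D ^ 4 * (1 + \<delta>) ^ m * (B k * ((1 / \<delta>) ^ k * (1 + \<delta>) ^ m))"
        using D \<delta> Bpos[of k] by (intro mult_right_mono mult_left_mono) auto
      also have "\<dots> = D ^ 4 * (B k * (1 / \<delta>) ^ k) * ((1 + \<delta>)\<^sup>2) ^ m"
        by (simp add: power2_eq_square power_mult_distrib)
      also have "\<dots> \<le> \<kappa> * (1 + \<epsilon>) ^ m"
        unfolding \<delta>(2) using assms(7) head[of 0] Bpos[of 0]
        by (intro mult_right_mono) (auto simp: \<kappa>_def)
      finally show ?thesis using that[OF bh nonneg] by blast
    qed
    have "(\<Sum>\<alpha>\<in>multi_indices n m. nrm (v (c \<alpha>)) powr ?\<rho>) \<le> (C * polydisc_norm n P) powr ?\<rho>"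
      using C(1) P unfolding bohnenblust_hille_def by blast
    then have "(\<Sum>\<alpha>\<in>multi_indices n m. nrm (v (c \<alpha>)) powr ?\<rho>) powr (1 / ?\<rho>)
      \<le> ((C * polydisc_norm n P) powr ?\<rho>) powr (1 / ?\<rho>)"
      using \<rho> by (intro powr_mono2) (auto intro: sum_nonneg)
    also have "\<dots> = C * polydisc_norm n P"
      using \<rho> C(2) polydisc_norm_nonneg[OF P] by (simp add: powr_powr)
    also have "\<dots> \<le> \<kappa> * (1 + \<epsilon>) ^ m * polydisc_norm n P"
      using C(3) polydisc_norm_nonneg[OF P] by (rule mult_right_mono)
    finally show ?thesis by (simp add: bh_exponent_def)
  qed
  ultimately show ?thesis by blast
qed

end
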